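(* Let $M$ be a $(2n+s)$-dimensional $S$-manifold whose $f$-sectional curvature with respect to the Riemannian (Levi-Civita) connection $\nabla$ is constant equal to $c$, and consider on $M$ the semi-symmetric metric connection $$\nabla^*_XY=\nabla_XY+\sum_{j=1}^s\eta^j(Y)X-\sum_{j=1}^s g(X,Y)\xi_j.$$ Then the $\mathcal{L}$-sectional curvature of $\nabla^*$ satisfies $$K^*_{\mathcal{L}}(X,Y)=\frac{c-s}{4}\left(1+3g(X,fY)^2\right)$$ for any orthonormal vector fields $X,Y\in\mathcal{L}$, and the scalar curvature of $M$ with respect to $\nabla^*$ satisfies $$\tau^*=\frac{n(n+1)(c-s)+(4ns+s(s-1))(2-s)}{2}.$$
   Context: A metric $f$-manifold is a $(2n+s)$-dimensional differentiable manifold $M$ ($n,s\geq 1$) with a $(1,1)$ tensor field $f$, vector fields $\xi_1,\dots,\xi_s$ (structure vector fields), 1-forms $\eta^1,\dots,\eta^s$ and a Riemannian metric $g$ such that $f^2=-I+\sum_{\alpha=1}^s\eta^\alpha\otimes\xi_\alpha$, $\eta^\alpha(\xi_\beta)=\delta_{\alpha\beta}$, $f\xi_\alpha=0$, $\eta^\alpha\circ f=0$, $g(fX,fY)=g(X,Y)-\sum_{\alpha=1}^s\eta^\alpha(X)\eta^\alpha(Y)$; moreover $\eta^\alpha(X)=g(X,\xi_\alpha)$ and $g(X,fY)=-g(fX,Y)$. The fundamental 2-form is $\Phi(X,Y)=g(X,fY)$. $M$ is an $S$-manifold if it is normal, i.e. $[f,f]+2\sum_{\alpha=1}^s d\eta^\alpha\otimes\xi_\alpha=0$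 with $[f,f](X,Y)=f^2[X,Y]+[fX,fY]-f[fX,Y]-f[X,fY]$, and for every $1\leq\alpha\leq s$: $\eta^1\wedge\cdots\wedge\eta^s\wedge(d\eta^\alpha)^n\neq 0$ everywhere and $\Phi=d\eta^\alpha$. Convention: $d\eta(X,Y)=\frac12\left(X\eta(Y)-Y\eta(X)-\eta([X,Y])\right)$. $\mathcal{L}$ is the distribution orthogonal to the span of $\xi_1,\dots,\xi_s$. For a linear connection $D$ with curvature $R^D(X,Y)Z=D_XD_YZ-D_YD_XZ-D_{[X,Y]}Z$, put $K^D(X,Y)=g(R^D(X,Y)Y,X)$ for orthonormal $X,Y$; write $K$ for $D=\nabla$ and $K^*$ for $D=\nabla^*$. The $f$-sectional curvature with respect to $\nabla$ is $K(X,fX)$ for unit $X\in\mathcal{L}$. The $\mathcal{L}$-sectional curvature of $\nabla^*$ is $K^*_{\mathcal{L}}(X,Y)=K^*(X,Y)$ for orthonormal $X,Y\in\mathcal{L}$. The scalar curvature with respect to $\nabla^*$ is $\tau^*=\frac12\sum_{i,j=1}^{2n+s}K^*(e_i,e_j)$ for any local orthonormal frame $\{e_1,\dots,e_{2n+s}\}$, the terms with $i=j$ being zero. *)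

theory Defs
  imports "HOL-Analysis.Analysis" "HOL-Library.Function_Algebras"
begin

text \<open>
  Tangent vectors act on real functions as directional derivatives, so they are functions
  themselves; the pointwise vector space structure makes tangent spaces linear subspaces.
\<close>

instantiation "fun" :: (type, real_vector) real_vector
begin

definition scaleR_fun :: "real \<Rightarrow> ('a \<Rightarrow> 'b) \<Rightarrow> 'a \<Rightarrow> 'b"
  where "scaleR_fun c F = (\<lambda>x. c *\<^sub>R F x)"

instance
  by standard (auto simp: scaleR_fun_def fun_eq_iff algebra_simps)

end


subsection \<open>Smooth manifolds\<close>

text \<open>The two predicates below are only used on open sets.\<close>

primrec Ck_on :: "nat \<Rightarrow> 'b::real_normed_vector set \<Rightarrow> ('b \<Rightarrow> 'c::real_normed_vector) \<Rightarrow> bool"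
  where
    "Ck_on 0 S F \<longleftrightarrow> continuous_on S F"
  | "Ck_on (Suc k) S F \<longleftrightarrow>
       F differentiable_on S \<and> (\<forall>w. Ck_on k S (\<lambda>x. frechet_derivative F (at x) w))"

definition smooth_on :: "'b::real_normed_vector set \<Rightarrow> ('b \<Rightarrow> 'c::real_normed_vector) \<Rightarrow> bool"
  where "smooth_on S F \<longleftrightarrow> (\<forall>k. Ck_on k S F)"

type_synonym ('a, 'b) atlas = "('a set \<times> ('a \<Rightarrow> 'b)) set"

definition smooth_manifold ::
    "('a::{t2_space, second_countable_topology}, 'b::euclidean_space) atlas \<Rightarrow> bool"
  where
    "smooth_manifold A \<longleftrightarrow>
       (\<forall>(U, \<phi>)\<in>A. open U \<and> open (\<phi> ` U) \<and> homeomorphism U (\<phi> ` U) \<phi> (inv_into U \<phi>)) \<and>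
       (\<Union>(U, \<phi>)\<in>A. U) = UNIV \<and>
       (\<forall>(U, \<phi>)\<in>A. \<forall>(V, \<psi>)\<in>A. smooth_on (\<phi> ` (U \<inter> V)) (\<psi> \<circ> inv_into U \<phi>))"

definition smooth_fun ::
    "('a::topological_space, 'b::euclidean_space) atlas \<Rightarrow> 'a set \<Rightarrow> ('a \<Rightarrow> real) \<Rightarrow> bool"
  where
    "smooth_fun A W h \<longleftrightarrow> (\<forall>(U, \<phi>)\<in>A. smooth_on (\<phi> ` (U \<inter> W)) (h \<circ> inv_into U \<phi>))"

definition smooth_near ::
    "('a::topological_space, 'b::euclidean_space) atlas \<Rightarrow> 'a \<Rightarrow> ('a \<Rightarrow> real) \<Rightarrow> bool"
  where "smooth_near A p h \<longleftrightarrow> (\<exists>W. open W \<and> p \<in> W \<and> smooth_fun A W h)"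


subsection \<open>Tangent vectors and vector fields\<close>

type_synonym 'a tangent = "('a \<Rightarrow> real) \<Rightarrow> real"
type_synonym 'a vfield = "'a \<Rightarrow> 'a tangent"

text \<open>
  A tangent vector at \<open>p\<close> is the operator differentiating functions that are smooth near \<open>p\<close> in a
  fixed direction of some chart around \<open>p\<close>.  On all other functions it takes the default value 0, so
  that a tangent vector is determined by its action on germs of smooth functions.
\<close>

definition tangent_space ::
    "('a::topological_space, 'b::euclidean_space) atlas \<Rightarrow> 'a \<Rightarrow> 'a tangent set"
  where
    "tangent_space A p =
       {v. \<exists>(U, \<phi>)\<in>A. p \<in> U \<and>
          (\<exists>w. v = (\<lambda>h. if smooth_near A p h
                        then frechet_derivative (h \<circ> inv_into U \<phi>) (at (\<phi> p)) w else 0))}"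

text \<open>
  Smooth vector fields on an open set \<open>U\<close>.  They are total functions, but their values outside \<open>U\<close>
  carry no meaning.
\<close>

definition vector_field_on ::
    "('a::topological_space, 'b::euclidean_space) atlas \<Rightarrow> 'a set \<Rightarrow> 'a vfield \<Rightarrow> bool"
  where
    "vector_field_on A U X \<longleftrightarrow>
       (\<forall>p\<in>U. X p \<in> tangent_space A p) \<and>
       (\<forall>V h. open V \<and> V \<subseteq> U \<and> smooth_fun A V h \<longrightarrow> smooth_fun A V (\<lambda>p. X p h))"

definition lie_bracket ::
    "('a::topological_space, 'b::euclidean_space) atlas \<Rightarrow> 'a vfield \<Rightarrow> 'a vfield \<Rightarrow> 'a vfield"
  where
    "lie_bracket A X Y =
       (\<lambda>p h. if smooth_near A p h then X p (\<lambda>q. Y q h) - Y p (\<lambda>q. X q h) else 0)"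


subsection \<open>Tensor fields and differential forms\<close>

definition one_form ::
    "('a::topological_space, 'b::euclidean_space) atlas \<Rightarrow> ('a \<Rightarrow> 'a tangent \<Rightarrow> real) \<Rightarrow> bool"
  where
    "one_form A \<omega> \<longleftrightarrow>
       (\<forall>p. \<forall>x\<in>tangent_space A p. \<forall>y\<in>tangent_space A p. \<forall>a b.
          \<omega> p (a *\<^sub>R x + b *\<^sub>R y) = a * \<omega> p x + b * \<omega> p y) \<and>
       (\<forall>U X. open U \<and> vector_field_on A U X \<longrightarrow> smooth_fun A U (\<lambda>p. \<omega> p (X p)))"

definition tensor_field_1_1 ::
    "('a::topological_space, 'b::euclidean_space) atlas \<Rightarrow> ('a \<Rightarrow> 'a tangent \<Rightarrow> 'a tangent) \<Rightarrow> bool"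
  where
    "tensor_field_1_1 A f \<longleftrightarrow>
       (\<forall>p. \<forall>x\<in>tangent_space A p. f p x \<in> tangent_space A p) \<and>
       (\<forall>p. \<forall>x\<in>tangent_space A p. \<forall>y\<in>tangent_space A p. \<forall>a b.
          f p (a *\<^sub>R x + b *\<^sub>R y) = a *\<^sub>R f p x + b *\<^sub>R f p y) \<and>
       (\<forall>U X. open U \<and> vector_field_on A U X \<longrightarrow> vector_field_on A U (\<lambda>p. f p (X p)))"

definition riemannian_metric ::
    "('a::topological_space, 'b::euclidean_space) atlas \<Rightarrow>
     ('a \<Rightarrow> 'a tangent \<Rightarrow> 'a tangent \<Rightarrow> real) \<Rightarrow> bool"
  where
    "riemannian_metric A g \<longleftrightarrow>
       (\<forall>p. \<forall>x\<in>tangent_space A p. \<forall>y\<in>tangent_space A p. g p x y = g p y x) \<and>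
       (\<forall>p. \<forall>x\<in>tangent_space A p. \<forall>y\<in>tangent_space A p. \<forall>z\<in>tangent_space A p. \<forall>a b.
          g p (a *\<^sub>R x + b *\<^sub>R y) z = a * g p x z + b * g p y z) \<and>
       (\<forall>p. \<forall>x\<in>tangent_space A p. x \<noteq> 0 \<longrightarrow> g p x x > 0) \<and>
       (\<forall>U X Y. open U \<and> vector_field_on A U X \<and> vector_field_on A U Y \<longrightarrow>
          smooth_fun A U (\<lambda>p. g p (X p) (Y p)))"

text \<open>Exterior derivative of a 1-form, with the factor 1/2 of the Kobayashi-Nomizu convention.\<close>

definition d_form ::
    "('a::topological_space, 'b::euclidean_space) atlas \<Rightarrow> ('a \<Rightarrow> 'a tangent \<Rightarrow> real) \<Rightarrow>
     'a vfield \<Rightarrow> 'a vfield \<Rightarrow> 'a \<Rightarrow> real"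
  where
    "d_form A \<omega> X Y p =
       (X p (\<lambda>q. \<omega> q (Y q)) - Y p (\<lambda>q. \<omega> q (X q)) - \<omega> p (lie_bracket A X Y p)) / 2"

text \<open>
  A form of degree \<open>k\<close> is represented by its values on vector fields \<open>V 0, \<dots>, V (k - 1)\<close>.  The
  exterior product is normalised by \<open>1 / (k + l)!\<close>, which is the convention matching \<open>d_form\<close>.
\<close>

type_synonym 'a form = "(nat \<Rightarrow> 'a vfield) \<Rightarrow> 'a \<Rightarrow> real"

definition wedge :: "nat \<Rightarrow> nat \<Rightarrow> 'a form \<Rightarrow> 'a form \<Rightarrow> 'a form"
  where
    "wedge k l \<omega> \<theta> = (\<lambda>V p.
       (\<Sum>\<sigma> | \<sigma> permutes {..<k + l}.
          of_int (sign \<sigma>) * \<omega> (\<lambda>i. V (\<sigma> i)) p * \<theta> (\<lambda>i. V (\<sigma> (k + i))) p) / fact (k + l))"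

primrec wedge_one_forms :: "nat \<Rightarrow> (nat \<Rightarrow> 'a \<Rightarrow> 'a tangent \<Rightarrow> real) \<Rightarrow> 'a form"
  where
    "wedge_one_forms 0 \<eta> = (\<lambda>V p. 1)"
  | "wedge_one_forms (Suc k) \<eta> =
       wedge k 1 (wedge_one_forms k \<eta>) (\<lambda>V p. \<eta> (Suc k) p (V 0 p))"

primrec two_form_power :: "nat \<Rightarrow> 'a form \<Rightarrow> 'a form"
  where
    "two_form_power 0 \<theta> = (\<lambda>V p. 1)"
  | "two_form_power (Suc k) \<theta> = wedge (2 * k) 2 (two_form_power k \<theta>) \<theta>"


subsection \<open>Linear connections and curvature\<close>

text \<open>
  A linear connection acts on smooth vector fields over arbitrary open sets, compatibly with
  restriction (last clause; restrictions to smaller open sets are covered because \<open>D X Y\<close> does not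
  mention the domain).
\<close>

definition linear_connection ::
    "('a::topological_space, 'b::euclidean_space) atlas \<Rightarrow>
     ('a vfield \<Rightarrow> 'a vfield \<Rightarrow> 'a vfield) \<Rightarrow> bool"
  where
    "linear_connection A D \<longleftrightarrow>
       (\<forall>U X Y. open U \<and> vector_field_on A U X \<and> vector_field_on A U Y \<longrightarrow>
          vector_field_on A U (D X Y)) \<and>
       (\<forall>U X X' Y. open U \<and> vector_field_on A U X \<and> vector_field_on A U X' \<and>
          vector_field_on A U Y \<longrightarrow>
          (\<forall>p\<in>U. D (\<lambda>q. X q + X' q) Y p = D X Y p + D X' Y p)) \<and>
       (\<forall>U h X Y. open U \<and> smooth_fun A U h \<and> vector_field_on A U X \<and>
          vector_field_on A U Y \<longrightarrow>
          (\<forall>p\<in>U. D (\<lambda>q. h q *\<^sub>R X q) Y p = h p *\<^sub>R D X Y p)) \<and>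
       (\<forall>U X Y Y'. open U \<and> vector_field_on A U X \<and> vector_field_on A U Y \<and>
          vector_field_on A U Y' \<longrightarrow>
          (\<forall>p\<in>U. D X (\<lambda>q. Y q + Y' q) p = D X Y p + D X Y' p)) \<and>
       (\<forall>U h X Y. open U \<and> smooth_fun A U h \<and> vector_field_on A U X \<and>
          vector_field_on A U Y \<longrightarrow>
          (\<forall>p\<in>U. D X (\<lambda>q. h q *\<^sub>R Y q) p = X p h *\<^sub>R Y p + h p *\<^sub>R D X Y p)) \<and>
       (\<forall>U X X' Y Y'. open U \<and> vector_field_on A U X \<and> vector_field_on A U X' \<and>
          vector_field_on A U Y \<and> vector_field_on A U Y' \<and>
          (\<forall>p\<in>U. X p = X' p \<and> Y p = Y' p) \<longrightarrow>
          (\<forall>p\<in>U. D X Y p = D X' Y' p))"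

definition levi_civita ::
    "('a::topological_space, 'b::euclidean_space) atlas \<Rightarrow>
     ('a \<Rightarrow> 'a tangent \<Rightarrow> 'a tangent \<Rightarrow> real) \<Rightarrow>
     ('a vfield \<Rightarrow> 'a vfield \<Rightarrow> 'a vfield) \<Rightarrow> bool"
  where
    "levi_civita A g D \<longleftrightarrow>
       linear_connection A D \<and>
       (\<forall>U X Y. open U \<and> vector_field_on A U X \<and> vector_field_on A U Y \<longrightarrow>
          (\<forall>p\<in>U. D X Y p - D Y X p = lie_bracket A X Y p)) \<and>
       (\<forall>U X Y Z. open U \<and> vector_field_on A U X \<and> vector_field_on A U Y \<and>
          vector_field_on A U Z \<longrightarrow>
          (\<forall>p\<in>U. X p (\<lambda>q. g q (Y q) (Z q)) = g p (D X Y p) (Z p) + g p (Y p) (D X Z p)))"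

definition curvature ::
    "('a::topological_space, 'b::euclidean_space) atlas \<Rightarrow>
     ('a vfield \<Rightarrow> 'a vfield \<Rightarrow> 'a vfield) \<Rightarrow> 'a vfield \<Rightarrow> 'a vfield \<Rightarrow> 'a vfield \<Rightarrow> 'a vfield"
  where
    "curvature A D X Y Z =
       (\<lambda>p. D X (D Y Z) p - D Y (D X Z) p - D (lie_bracket A X Y) Z p)"

text \<open>The following quantity is only used for orthonormal \<open>X\<close> and \<open>Y\<close>.\<close>

definition sectional_curvature ::
    "('a::topological_space, 'b::euclidean_space) atlas \<Rightarrow>
     ('a \<Rightarrow> 'a tangent \<Rightarrow> 'a tangent \<Rightarrow> real) \<Rightarrow>
     ('a vfield \<Rightarrow> 'a vfield \<Rightarrow> 'a vfield) \<Rightarrow> 'a vfield \<Rightarrow> 'a vfield \<Rightarrow> 'a \<Rightarrow> real"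
  where
    "sectional_curvature A g D X Y p = g p (curvature A D X Y Y p) (X p)"

definition local_orthonormal_frame ::
    "('a::topological_space, 'b::euclidean_space) atlas \<Rightarrow>
     ('a \<Rightarrow> 'a tangent \<Rightarrow> 'a tangent \<Rightarrow> real) \<Rightarrow> 'a set \<Rightarrow> (nat \<Rightarrow> 'a vfield) \<Rightarrow> bool"
  where
    "local_orthonormal_frame A g U e \<longleftrightarrow>
       open U \<and>
       (\<forall>i\<in>{1..DIM('b)}. vector_field_on A U (e i)) \<and>
       (\<forall>p\<in>U. \<forall>i\<in>{1..DIM('b)}. \<forall>j\<in>{1..DIM('b)}.
          g p (e i p) (e j p) = (if i = j then 1 else 0))"

text \<open>Scalar curvature at \<open>p\<close>, computed in a local orthonormal frame \<open>e\<close> around \<open>p\<close>.\<close>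

definition scalar_curvature ::
    "('a::topological_space, 'b::euclidean_space) atlas \<Rightarrow>
     ('a \<Rightarrow> 'a tangent \<Rightarrow> 'a tangent \<Rightarrow> real) \<Rightarrow>
     ('a vfield \<Rightarrow> 'a vfield \<Rightarrow> 'a vfield) \<Rightarrow> (nat \<Rightarrow> 'a vfield) \<Rightarrow> 'a \<Rightarrow> real"
  where
    "scalar_curvature A g D e p =
       (\<Sum>i = 1..DIM('b). \<Sum>j = 1..DIM('b).
          if i = j then 0 else sectional_curvature A g D (e i) (e j) p) / 2"


subsection \<open>Metric f-manifolds and S-manifolds\<close>

definition metric_f_manifold ::
    "('a::{t2_space, second_countable_topology}, 'b::euclidean_space) atlas \<Rightarrow> nat \<Rightarrow> nat \<Rightarrow>
     ('a \<Rightarrow> 'a tangent \<Rightarrow> 'a tangent) \<Rightarrow> (nat \<Rightarrow> 'a vfield) \<Rightarrow>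
     (nat \<Rightarrow> 'a \<Rightarrow> 'a tangent \<Rightarrow> real) \<Rightarrow> ('a \<Rightarrow> 'a tangent \<Rightarrow> 'a tangent \<Rightarrow> real) \<Rightarrow> bool"
  where
    "metric_f_manifold A n s f \<xi> \<eta> g \<longleftrightarrow>
       smooth_manifold A \<and> 1 \<le> n \<and> 1 \<le> s \<and> DIM('b) = 2 * n + s \<and>
       tensor_field_1_1 A f \<and>
       (\<forall>\<alpha>\<in>{1..s}. vector_field_on A UNIV (\<xi> \<alpha>)) \<and>
       (\<forall>\<alpha>\<in>{1..s}. one_form A (\<eta> \<alpha>)) \<and>
       riemannian_metric A g \<and>
       (\<forall>p. \<forall>x\<in>tangent_space A p. f p (f p x) = - x + (\<Sum>\<alpha> = 1..s. \<eta> \<alpha> p x *\<^sub>R \<xi> \<alpha> p)) \<and>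
       (\<forall>p. \<forall>\<alpha>\<in>{1..s}. \<forall>\<beta>\<in>{1..s}. \<eta> \<alpha> p (\<xi> \<beta> p) = (if \<alpha> = \<beta> then 1 else 0)) \<and>
       (\<forall>p. \<forall>\<alpha>\<in>{1..s}. f p (\<xi> \<alpha> p) = 0) \<and>
       (\<forall>p. \<forall>\<alpha>\<in>{1..s}. \<forall>x\<in>tangent_space A p. \<eta> \<alpha> p (f p x) = 0) \<and>
       (\<forall>p. \<forall>x\<in>tangent_space A p. \<forall>y\<in>tangent_space A p.
          g p (f p x) (f p y) = g p x y - (\<Sum>\<alpha> = 1..s. \<eta> \<alpha> p x * \<eta> \<alpha> p y)) \<and>
       (\<forall>p. \<forall>\<alpha>\<in>{1..s}. \<forall>x\<in>tangent_space A p. \<eta> \<alpha> p x = g p x (\<xi> \<alpha> p)) \<and>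
       (\<forall>p. \<forall>x\<in>tangent_space A p. \<forall>y\<in>tangent_space A p. g p x (f p y) = - g p (f p x) y)"

definition fundamental_form ::
    "('a \<Rightarrow> 'a tangent \<Rightarrow> 'a tangent) \<Rightarrow> ('a \<Rightarrow> 'a tangent \<Rightarrow> 'a tangent \<Rightarrow> real) \<Rightarrow>
     'a vfield \<Rightarrow> 'a vfield \<Rightarrow> 'a \<Rightarrow> real"
  where "fundamental_form f g X Y p = g p (X p) (f p (Y p))"

definition nijenhuis ::
    "('a::topological_space, 'b::euclidean_space) atlas \<Rightarrow> ('a \<Rightarrow> 'a tangent \<Rightarrow> 'a tangent) \<Rightarrow>
     'a vfield \<Rightarrow> 'a vfield \<Rightarrow> 'a vfield"
  where
    "nijenhuis A f X Y = (\<lambda>p.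
       f p (f p (lie_bracket A X Y p))
       + lie_bracket A (\<lambda>q. f q (X q)) (\<lambda>q. f q (Y q)) p
       - f p (lie_bracket A (\<lambda>q. f q (X q)) Y p)
       - f p (lie_bracket A X (\<lambda>q. f q (Y q)) p))"

definition S_manifold ::
    "('a::{t2_space, second_countable_topology}, 'b::euclidean_space) atlas \<Rightarrow> nat \<Rightarrow> nat \<Rightarrow>
     ('a \<Rightarrow> 'a tangent \<Rightarrow> 'a tangent) \<Rightarrow> (nat \<Rightarrow> 'a vfield) \<Rightarrow>
     (nat \<Rightarrow> 'a \<Rightarrow> 'a tangent \<Rightarrow> real) \<Rightarrow> ('a \<Rightarrow> 'a tangent \<Rightarrow> 'a tangent \<Rightarrow> real) \<Rightarrow> bool"
  where
    "S_manifold A n s f \<xi> \<eta> g \<longleftrightarrow>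
       metric_f_manifold A n s f \<xi> \<eta> g \<and>
       (\<forall>U X Y. open U \<and> vector_field_on A U X \<and> vector_field_on A U Y \<longrightarrow>
          (\<forall>p\<in>U. nijenhuis A f X Y p
                   + 2 *\<^sub>R (\<Sum>\<alpha> = 1..s. d_form A (\<eta> \<alpha>) X Y p *\<^sub>R \<xi> \<alpha> p) = 0)) \<and>
       (\<forall>\<alpha>\<in>{1..s}.
          (\<forall>p. \<exists>U V. open U \<and> p \<in> U \<and> (\<forall>i<2 * n + s. vector_field_on A U (V i)) \<and>
             wedge s (2 * n) (wedge_one_forms s \<eta>)
               (two_form_power n (\<lambda>V. d_form A (\<eta> \<alpha>) (V 0) (V 1))) V p \<noteq> 0) \<and>
          (\<forall>U X Y. open U \<and> vector_field_on A U X \<and> vector_field_on A U Y \<longrightarrow>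
             (\<forall>p\<in>U. fundamental_form f g X Y p = d_form A (\<eta> \<alpha>) X Y p)))"

text \<open>The distribution orthogonal to the structure vector fields, and its local sections.\<close>

definition L_distribution ::
    "('a::topological_space, 'b::euclidean_space) atlas \<Rightarrow> nat \<Rightarrow> (nat \<Rightarrow> 'a vfield) \<Rightarrow>
     ('a \<Rightarrow> 'a tangent \<Rightarrow> 'a tangent \<Rightarrow> real) \<Rightarrow> 'a \<Rightarrow> 'a tangent set"
  where
    "L_distribution A s \<xi> g p =
       {x \<in> tangent_space A p. \<forall>v\<in>span ((\<lambda>\<alpha>. \<xi> \<alpha> p) ` {1..s}). g p x v = 0}"

definition L_section ::
    "('a::topological_space, 'b::euclidean_space) atlas \<Rightarrow> nat \<Rightarrow> (nat \<Rightarrow> 'a vfield) \<Rightarrow>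
     ('a \<Rightarrow> 'a tangent \<Rightarrow> 'a tangent \<Rightarrow> real) \<Rightarrow> 'a set \<Rightarrow> 'a vfield \<Rightarrow> bool"
  where
    "L_section A s \<xi> g U X \<longleftrightarrow>
       vector_field_on A U X \<and> (\<forall>p\<in>U. X p \<in> L_distribution A s \<xi> g p)"

definition constant_f_sectional_curvature ::
    "('a::topological_space, 'b::euclidean_space) atlas \<Rightarrow> nat \<Rightarrow>
     ('a \<Rightarrow> 'a tangent \<Rightarrow> 'a tangent) \<Rightarrow> (nat \<Rightarrow> 'a vfield) \<Rightarrow>
     ('a \<Rightarrow> 'a tangent \<Rightarrow> 'a tangent \<Rightarrow> real) \<Rightarrow>
     ('a vfield \<Rightarrow> 'a vfield \<Rightarrow> 'a vfield) \<Rightarrow> real \<Rightarrow> bool"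
  where
    "constant_f_sectional_curvature A s f \<xi> g D c \<longleftrightarrow>
       (\<forall>U X. open U \<and> L_section A s \<xi> g U X \<and> (\<forall>p\<in>U. g p (X p) (X p) = 1) \<longrightarrow>
          (\<forall>p\<in>U. sectional_curvature A g D X (\<lambda>q. f q (X q)) p = c))"

definition semi_symmetric_metric_connection ::
    "nat \<Rightarrow> (nat \<Rightarrow> 'a vfield) \<Rightarrow> (nat \<Rightarrow> 'a \<Rightarrow> 'a tangent \<Rightarrow> real) \<Rightarrow>
     ('a \<Rightarrow> 'a tangent \<Rightarrow> 'a tangent \<Rightarrow> real) \<Rightarrow>
     ('a vfield \<Rightarrow> 'a vfield \<Rightarrow> 'a vfield) \<Rightarrow> 'a vfield \<Rightarrow> 'a vfield \<Rightarrow> 'a vfield"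
  where
    "semi_symmetric_metric_connection s \<xi> \<eta> g D X Y = (\<lambda>p.
       D X Y p + (\<Sum>j = 1..s. \<eta> j p (Y p) *\<^sub>R X p) - (\<Sum>j = 1..s. g p (X p) (Y p) *\<^sub>R \<xi> j p))"

end

(*
  Normality and Phi = d eta make every structure vector field Killing, whence
  nabla_X xi_a = - f X; differentiating f^2 and using the cyclic identity for nabla Phi (which is the
  first Bianchi identity applied to R(X,Y) xi_a) yields
  (nabla_X f) Y = g(fX,fY) xi + eta(Y) f^2 X, where xi and eta are the sums of the xi_a and eta^a.
  This determines R on all arguments involving some xi_a and shows that on L the failure of R to
  commute with f is a multiple of s.  After subtracting the expected curvature tensor, R restricted to
  L has the symmetries of a Kaehler curvature tensor with vanishing holomorphic sectional curvature,
  so its sectional curvatures vanish by polarisation.  For orthonormal X, Y a direct computation gives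
  K*(X,Y) = K(X,Y) - s + eta(X)^2 + eta(Y)^2, and the scalar curvature follows from Parseval's
  identity in the given frame.

  Tensoriality of R costs nothing: g(R(X,Y)Z,W) depends on W pointwise by definition, and the
  symmetries of R move every argument into the last slot.
*)

theory Submission
  imports Defs
begin

subsection \<open>Smooth functions\<close>

text \<open>The hypotheses quantify over smooth fields on arbitrary open sets, never over single
  tangent vectors. Identities are therefore proved for fields on a fixed open \<open>U\<close> and
  read off at a point, and no field is ever extended or cut off: two fields are compared by testing
  on their own difference, and a smaller domain (that of a germ, or the set where a field is
  nonzero) is reached by instantiating the locale again. The covectors
  \<open>\<eta> \<alpha>\<close> are replaced by \<open>g p x (\<xi> \<alpha> p)\<close>, and every
  f is moved into the second slot of g, so g(fX,fY) shows up as -g(X,f(fY)). The expected curvature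
  on L is a two-parameter tensor: one parameter relation comes from the defect of commutation with
  f, the other from the value c on f-planes. The frame in the scalar curvature need not be adapted
  to L and its complement, so planes cannot be counted by type. Its sums are traces of the
  orthogonal projection onto L, whose rank is 2n.\<close>

lemma Ck_on_cong:
  assumes "open S" "\<And>x. x \<in> S \<Longrightarrow> F x = G x" "Ck_on k S F"
  shows "Ck_on k S G"
  using assms(2,3)
proof (induction k arbitrary: F G)
  case 0
  then show ?case by (metis Ck_on.simps(1) continuous_on_cong)
next
  case (Suc k)
  have der: "(F has_derivative D) (at x) \<longleftrightarrow> (G has_derivative D) (at x)" if "x \<in> S" for x D
    using has_derivative_transform_within_open[OF _ assms(1) that] Suc.prems(1) by metis
  have "G differentiable_on S"
    unfolding differentiable_on_eq_differentiable_at[OF assms(1)]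
  proof
    fix x assume x: "x \<in> S"
    then have "F differentiable (at x)"
      using Suc.prems(2) by (simp add: differentiable_on_eq_differentiable_at[OF assms(1)])
    then show "G differentiable (at x)"
      unfolding differentiable_def using der[OF x] by blast
  qed
  moreover have "Ck_on k S (\<lambda>x. frechet_derivative G (at x) w)" for w
  proof (rule Suc.IH)
    show "Ck_on k S (\<lambda>x. frechet_derivative F (at x) w)"
      using Suc.prems(2) by simp
    show "frechet_derivative F (at x) w = frechet_derivative G (at x) w" if "x \<in> S" for x
      \<comment> \<open>\<open>frechet_derivative\<close> is a choice among all derivatives;
        equivalent predicates yield the same choice.\<close>
      unfolding frechet_derivative_def der[OF that] ..
  qed
  ultimately show ?case by simp
qed

lemma Ck_on_subset: "Ck_on k S F \<Longrightarrow> T \<subseteq> S \<Longrightarrow> Ck_on k T F"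
  by (induction k arbitrary: F) (auto intro: continuous_on_subset differentiable_on_subset)

lemma Ck_on_lower: "Ck_on (Suc k) S F \<Longrightarrow> Ck_on k S F"
  by (induction k arbitrary: F) (auto intro: differentiable_imp_continuous_on)

lemma Ck_on_Suc_has_derivative:
  assumes "open S" "Ck_on (Suc k) S F" "x \<in> S"
  shows "(F has_derivative frechet_derivative F (at x)) (at x)"
  using assms(2,3)
  by (simp add: differentiable_on_eq_differentiable_at[OF assms(1)] frechet_derivative_works)

lemma Ck_on_SucI:
  assumes "open S" "\<And>x. x \<in> S \<Longrightarrow> (F has_derivative F' x) (at x)" "\<And>w. Ck_on k S (\<lambda>x. F' x w)"
  shows "Ck_on (Suc k) S F"
proof -
  have "F differentiable_on S"
    using assms(2) unfolding differentiable_on_eq_differentiable_at[OF assms(1)] differentiable_def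
    by blast
  moreover have "F' x w = frechet_derivative F (at x) w" if "x \<in> S" for x w
    using frechet_derivative_at[OF assms(2)[OF that]] by simp
  ultimately show ?thesis
    using Ck_on_cong[OF assms(1) _ assms(3)] by simp
qed

lemma Ck_on_const: "open S \<Longrightarrow> Ck_on k S (\<lambda>x. a)"
  by (induction k arbitrary: a) (auto intro: Ck_on_SucI[where F'="\<lambda>x w. 0"] simp del: Ck_on.simps(2))

lemma Ck_on_add:
  assumes "open S" "Ck_on k S F" "Ck_on k S G"
  shows "Ck_on k S (\<lambda>x. F x + G x)"
  using assms(2,3)
proof (induction k arbitrary: F G)
  case 0
  then show ?case by (auto intro: continuous_intros)
next
  case (Suc k)
  note d = Ck_on_Suc_has_derivative[OF assms(1) Suc.prems(1)]
    Ck_on_Suc_has_derivative[OF assms(1) Suc.prems(2)]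
  show ?case
    using Suc by (intro Ck_on_SucI[OF assms(1) has_derivative_add[OF d]]) auto
qed

lemma Ck_on_mult:
  fixes F G :: "'b::real_normed_vector \<Rightarrow> real"
  assumes "open S" "Ck_on k S F" "Ck_on k S G"
  shows "Ck_on k S (\<lambda>x. F x * G x)"
  using assms(2,3)
proof (induction k arbitrary: F G)
  case 0
  then show ?case by (auto intro: continuous_intros)
next
  case (Suc k)
  note d = Ck_on_Suc_has_derivative[OF assms(1) Suc.prems(1)]
    Ck_on_Suc_has_derivative[OF assms(1) Suc.prems(2)]
  show ?case
    using Suc Ck_on_lower[OF Suc.prems(1)] Ck_on_lower[OF Suc.prems(2)]
    by (intro Ck_on_SucI[OF assms(1) has_derivative_mult[OF d]] Ck_on_add[OF assms(1)]) auto
qed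

text \<open>With u = F^(-1/2) the derivative is -(1/2) u^3 F', a product of u itself with a
  derivative of F, so level \<open>k\<close> for u yields level \<open>Suc k\<close>. This is what
  makes normalising a nowhere vanishing field a smooth operation.\<close>

lemma Ck_on_inverse_sqrt:
  fixes F :: "'b::real_normed_vector \<Rightarrow> real"
  assumes "open S" "\<And>x. x \<in> S \<Longrightarrow> F x > 0" "\<And>k. Ck_on k S F"
  shows "Ck_on k S (\<lambda>x. inverse (sqrt (F x)))"
proof (induction k)
  case 0
  have "Ck_on 0 S F" by (rule assms(3))
  then show ?case using assms(2) by (fastforce intro!: continuous_intros)
next
  case (Suc k)
  let ?u = "\<lambda>x. inverse (sqrt (F x))"
  have d: "(?u has_derivative (\<lambda>w. (- 1/2) * (?u x * (?u x * (?u x * frechet_derivative F (at x) w))))) (at x)"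
    if x: "x \<in> S" for x
  proof -
    note dF = Ck_on_Suc_has_derivative[OF assms(1) assms(3) x]
    have "((\<lambda>t. inverse (sqrt t)) has_real_derivative (- 1/2) * (?u x * (?u x * ?u x))) (at (F x))"
      using assms(2)[OF x] by (auto intro!: derivative_eq_intros simp: field_simps power2_eq_square)
    from DERIV_compose_FDERIV[OF this dF] show ?thesis
      by (simp add: mult_ac)
  qed
  have F': "Ck_on k S (\<lambda>x. frechet_derivative F (at x) w)" for w
    using assms(3)[of "Suc k"] by simp
  show ?case
    by (intro Ck_on_SucI[OF assms(1) d] Ck_on_mult Ck_on_const assms(1) Suc F')
qed

lemma smooth_on_differentiable:
  assumes "open S" "smooth_on S F" "x \<in> S"
  shows "F differentiable (at x)"
proof -
  have "Ck_on (Suc 0) S F" using assms(2) by (simp only: smooth_on_def)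
  then show ?thesis using assms by (simp add: differentiable_on_eq_differentiable_at)
qed

lemma smooth_on_continuous: "smooth_on S F \<Longrightarrow> continuous_on S F"
  using Ck_on.simps(1) unfolding smooth_on_def by blast


section \<open>Functions that are smooth in every chart\<close>

locale manifold =
  fixes A :: "('a::{t2_space, second_countable_topology}, 'b::euclidean_space) atlas"
  assumes manifold: "smooth_manifold A"
begin

lemma chart:
  assumes "(V, \<phi>) \<in> A"
  shows "open V" "open (\<phi> ` V)" "homeomorphism V (\<phi> ` V) \<phi> (inv_into V \<phi>)" "inj_on \<phi> V"
proof -
  show "open V" "open (\<phi> ` V)" and h: "homeomorphism V (\<phi> ` V) \<phi> (inv_into V \<phi>)"
    using manifold assms unfolding smooth_manifold_def by auto
  show "inj_on \<phi> V"
    using h unfolding homeomorphism_def by (metis inj_on_inverseI)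
qed

lemma open_chart_image:
  assumes "(V, \<phi>) \<in> A" "open W"
  shows "open (\<phi> ` (V \<inter> W))"
proof -
  have "openin (top_of_set (\<phi> ` V)) (\<phi> ` (V \<inter> W))"
    using homeomorphism_imp_open_map[OF chart(3)[OF assms(1)]] assms(2) by blast
  then show ?thesis using chart(2)[OF assms(1)] openin_open_trans by blast
qed

lemma chart_at: obtains V \<phi> where "(V, \<phi>) \<in> A" "p \<in> V"
  using manifold unfolding smooth_manifold_def by blast

lemma smooth_funD: "smooth_fun A W h \<Longrightarrow> (V, \<phi>) \<in> A \<Longrightarrow> smooth_on (\<phi> ` (V \<inter> W)) (h \<circ> inv_into V \<phi>)"
  unfolding smooth_fun_def by auto

lemma smooth_fun_cong:
  assumes "open W" "\<And>q. q \<in> W \<Longrightarrow> h q = k q" "smooth_fun A W h"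
  shows "smooth_fun A W k"
  unfolding smooth_fun_def smooth_on_def
proof safe
  fix V \<phi> m assume c: "(V, \<phi>) \<in> A"
  have "Ck_on m (\<phi> ` (V \<inter> W)) (h \<circ> inv_into V \<phi>)"
    using smooth_funD[OF assms(3) c] by (simp add: smooth_on_def)
  then show "Ck_on m (\<phi> ` (V \<inter> W)) (k \<circ> inv_into V \<phi>)"
    by (rule Ck_on_cong[OF open_chart_image[OF c assms(1)], rotated])
      (use assms(2) chart(4)[OF c] in auto)
qed

lemma smooth_fun_subset: "smooth_fun A W h \<Longrightarrow> W' \<subseteq> W \<Longrightarrow> smooth_fun A W' h"
  unfolding smooth_fun_def smooth_on_def
  by (fastforce intro: Ck_on_subset)

lemma smooth_fun_const: "open W \<Longrightarrow> smooth_fun A W (\<lambda>q. a)"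
  unfolding smooth_fun_def smooth_on_def o_def using Ck_on_const open_chart_image by blast

lemma smooth_fun_add:
  "open W \<Longrightarrow> smooth_fun A W h \<Longrightarrow> smooth_fun A W k \<Longrightarrow> smooth_fun A W (\<lambda>q. h q + k q)"
  unfolding smooth_fun_def smooth_on_def o_def using Ck_on_add open_chart_image by fast

lemma smooth_fun_mult:
  "open W \<Longrightarrow> smooth_fun A W h \<Longrightarrow> smooth_fun A W k \<Longrightarrow> smooth_fun A W (\<lambda>q. h q * k q)"
  unfolding smooth_fun_def smooth_on_def o_def using Ck_on_mult open_chart_image by fast

lemma smooth_fun_minus:
  "open W \<Longrightarrow> smooth_fun A W h \<Longrightarrow> smooth_fun A W (\<lambda>q. - h q)"
  using smooth_fun_mult[OF _ smooth_fun_const[of W "-1"]] by simp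

lemma smooth_fun_diff:
  "open W \<Longrightarrow> smooth_fun A W h \<Longrightarrow> smooth_fun A W k \<Longrightarrow> smooth_fun A W (\<lambda>q. h q - k q)"
  using smooth_fun_add[OF _ _ smooth_fun_minus] by simp

lemma smooth_fun_sum:
  "open W \<Longrightarrow> (\<And>i. i \<in> I \<Longrightarrow> smooth_fun A W (h i)) \<Longrightarrow> smooth_fun A W (\<lambda>q. \<Sum>i\<in>I. h i q)"
  by (induction I rule: infinite_finite_induct) (auto intro: smooth_fun_add smooth_fun_const)

lemma smooth_fun_inverse_sqrt:
  assumes "open W" "smooth_fun A W h" "\<And>q. q \<in> W \<Longrightarrow> h q > 0"
  shows "smooth_fun A W (\<lambda>q. inverse (sqrt (h q)))"
  unfolding smooth_fun_def smooth_on_def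
proof safe
  fix V \<phi> m assume c: "(V, \<phi>) \<in> A"
  have "Ck_on m (\<phi> ` (V \<inter> W)) (\<lambda>x. inverse (sqrt ((h \<circ> inv_into V \<phi>) x)))"
  proof (rule Ck_on_inverse_sqrt[OF open_chart_image[OF c assms(1)]])
    show "(h \<circ> inv_into V \<phi>) x > 0" if "x \<in> \<phi> ` (V \<inter> W)" for x
      using that chart(4)[OF c] assms(3) by auto
    show "Ck_on k (\<phi> ` (V \<inter> W)) (h \<circ> inv_into V \<phi>)" for k
      using smooth_funD[OF assms(2) c] by (simp add: smooth_on_def)
  qed
  then show "Ck_on m (\<phi> ` (V \<inter> W)) ((\<lambda>q. inverse (sqrt (h q))) \<circ> inv_into V \<phi>)"
    by (simp add: o_def)
qed

lemma smooth_fun_continuous: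
  assumes "open W" "smooth_fun A W h"
  shows "continuous_on W h"
proof -
  have "isCont h q" if q: "q \<in> W" for q
  proof -
    obtain V \<phi> where c: "(V, \<phi>) \<in> A" "q \<in> V" by (rule chart_at)
    have "continuous_on (V \<inter> W) \<phi>"
      using chart(3)[OF c(1)] homeomorphism_cont1 continuous_on_subset by blast
    moreover have "continuous_on (\<phi> ` (V \<inter> W)) (h \<circ> inv_into V \<phi>)"
      by (rule smooth_on_continuous[OF smooth_funD[OF assms(2) c(1)]])
    ultimately have "continuous_on (V \<inter> W) ((h \<circ> inv_into V \<phi>) \<circ> \<phi>)"
      by (rule continuous_on_compose)
    moreover have "((h \<circ> inv_into V \<phi>) \<circ> \<phi>) r = h r" if "r \<in> V \<inter> W" for r
      using that chart(4)[OF c(1)] by simp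
    ultimately have "continuous_on (V \<inter> W) h"
      by (metis (no_types, lifting) continuous_on_cong)
    then show ?thesis
      using c q assms(1) chart(1)[OF c(1)] continuous_on_eq_continuous_at by blast
  qed
  then show ?thesis by (simp add: continuous_at_imp_continuous_on)
qed

lemma smooth_nearI: "open W \<Longrightarrow> p \<in> W \<Longrightarrow> smooth_fun A W h \<Longrightarrow> smooth_near A p h"
  unfolding smooth_near_def by blast

lemma smooth_near_cong:
  assumes "open W" "p \<in> W" "\<And>q. q \<in> W \<Longrightarrow> h q = k q"
  shows "smooth_near A p h \<longleftrightarrow> smooth_near A p k"
proof -
  have *: "smooth_near A p k" if h: "smooth_near A p h" and hk: "\<And>q. q \<in> W \<Longrightarrow> h q = k q" for h k
  proof -
    obtain W' where W': "open W'" "p \<in> W'" "smooth_fun A W' h"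
      using h unfolding smooth_near_def by blast
    have "smooth_fun A (W \<inter> W') h" by (rule smooth_fun_subset[OF W'(3)]) simp
    then have "smooth_fun A (W \<inter> W') k"
      by (rule smooth_fun_cong[rotated 2]) (use hk assms(1) W'(1) in auto)
    then show ?thesis by (rule smooth_nearI[rotated 2]) (use W' assms in auto)
  qed
  show ?thesis using *[of h k] *[of k h] assms(3) by auto
qed

lemma smooth_near_common:
  assumes "smooth_near A p h" "smooth_near A p k"
  obtains W where "open W" "p \<in> W" "smooth_fun A W h" "smooth_fun A W k"
proof -
  obtain W W' where "open W" "p \<in> W" "smooth_fun A W h" "open W'" "p \<in> W'" "smooth_fun A W' k"
    using assms unfolding smooth_near_def by blast
  then show thesis
    using that[of "W \<inter> W'"] smooth_fun_subset[of W h "W \<inter> W'"] smooth_fun_subset[of W' k "W \<inter> W'"]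
    by auto
qed

lemma smooth_near_differentiable:
  assumes "smooth_near A p h" "(V, \<phi>) \<in> A" "p \<in> V"
  shows "(h \<circ> inv_into V \<phi>) differentiable (at (\<phi> p))"
proof -
  obtain W where "open W" "p \<in> W" "smooth_fun A W h"
    using assms(1) unfolding smooth_near_def by blast
  then show ?thesis
    using smooth_on_differentiable[OF open_chart_image[OF assms(2)] smooth_funD[OF _ assms(2)]] assms(3)
    by blast
qed


subsection \<open>Tangent spaces\<close>

text \<open>A tangent vector with its chart held fixed, so that the tangent space becomes the range
  of a linear map.\<close>

definition chart_vector :: "'a set \<Rightarrow> ('a \<Rightarrow> 'b) \<Rightarrow> 'a \<Rightarrow> 'b \<Rightarrow> 'a tangent" where
  "chart_vector V \<phi> p w =
     (\<lambda>h. if smooth_near A p h then frechet_derivative (h \<circ> inv_into V \<phi>) (at (\<phi> p)) w else 0)"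

lemma linear_chart_vector:
  assumes "(V, \<phi>) \<in> A" "p \<in> V"
  shows "linear (chart_vector V \<phi> p)"
proof -
  have "linear (frechet_derivative (h \<circ> inv_into V \<phi>) (at (\<phi> p)))" if "smooth_near A p h" for h
    using smooth_near_differentiable[OF that assms] by (rule linear_frechet_derivative)
  then show ?thesis
    by (intro linearI) (auto simp: chart_vector_def fun_eq_iff scaleR_fun_def linear_add linear_scale)
qed

text \<open>Chain rule for the transition map. It collapses the union over all charts in
  \<open>tangent_space\<close> to the range belonging to one chart.\<close>

lemma chart_vector_change:
  assumes "(V, \<phi>) \<in> A" "p \<in> V" "(V', \<psi>) \<in> A" "p \<in> V'"
  shows "chart_vector V' \<psi> p w =
    chart_vector V \<phi> p (frechet_derivative (\<phi> \<circ> inv_into V' \<psi>) (at (\<psi> p)) w)"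
proof
  fix h
  show "chart_vector V' \<psi> p w h =
    chart_vector V \<phi> p (frechet_derivative (\<phi> \<circ> inv_into V' \<psi>) (at (\<psi> p)) w) h"
  proof (cases "smooth_near A p h")
    case True
    have "smooth_on (\<psi> ` (V' \<inter> V)) (\<phi> \<circ> inv_into V' \<psi>)"
      using manifold assms unfolding smooth_manifold_def by blast
    then have d1: "((\<phi> \<circ> inv_into V' \<psi>) has_derivative
        frechet_derivative (\<phi> \<circ> inv_into V' \<psi>) (at (\<psi> p))) (at (\<psi> p))"
      using smooth_on_differentiable[OF open_chart_image[OF assms(3) chart(1)[OF assms(1)]]] assms
      by (metis IntI imageI frechet_derivative_works[THEN iffD1])
    have e: "(\<phi> \<circ> inv_into V' \<psi>) (\<psi> p) = \<phi> p"
      using chart(4)[OF assms(3)] assms(4) by simp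
    have d2: "((h \<circ> inv_into V \<phi>) has_derivative
        frechet_derivative (h \<circ> inv_into V \<phi>) (at (\<phi> p))) (at ((\<phi> \<circ> inv_into V' \<psi>) (\<psi> p)))"
      unfolding e using smooth_near_differentiable[OF True assms(1,2)] frechet_derivative_works[THEN iffD1] by blast
    have "((h \<circ> inv_into V' \<psi>) has_derivative
        frechet_derivative (h \<circ> inv_into V \<phi>) (at (\<phi> p)) \<circ>
        frechet_derivative (\<phi> \<circ> inv_into V' \<psi>) (at (\<psi> p))) (at (\<psi> p))"
      by (rule has_derivative_transform_within_open[OF diff_chain_at[OF d1 d2]
            open_chart_image[OF assms(3) chart(1)[OF assms(1)]]])
        (use assms chart(4)[OF assms(3)] chart(4)[OF assms(1)] in auto)
    from frechet_derivative_at[OF this] True show ?thesis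
      by (simp add: chart_vector_def) (metis comp_apply)
  qed (simp add: chart_vector_def)
qed

lemma tangent_space_eq_range:
  assumes "(V, \<phi>) \<in> A" "p \<in> V"
  shows "tangent_space A p = range (chart_vector V \<phi> p)"
proof -
  have "tangent_space A p = (\<Union>(V, \<phi>)\<in>{(V, \<phi>) \<in> A. p \<in> V}. range (chart_vector V \<phi> p))"
    unfolding tangent_space_def chart_vector_def by auto
  moreover have "range (chart_vector V' \<psi> p) \<subseteq> range (chart_vector V \<phi> p)"
    if "(V', \<psi>) \<in> A" "p \<in> V'" for V' \<psi>
    using chart_vector_change[OF assms that] by auto
  ultimately show ?thesis using assms by blast
qed

lemma subspace_tangent_space: "subspace (tangent_space A p)"
proof -
  obtain V \<phi> where "(V, \<phi>) \<in> A" "p \<in> V" by (rule chart_at)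
  then show ?thesis
    using tangent_space_eq_range linear_chart_vector linear_subspace_image subspace_UNIV by metis
qed

text \<open>The images of \<open>Basis\<close> under \<open>chart_vector\<close> span. The bound
  later forces an orthonormal family of DIM('b) vectors to be complete.\<close>

lemma dim_tangent_space:
  assumes "independent B" "B \<subseteq> tangent_space A p"
  shows "finite B \<and> card B \<le> DIM('b)"
proof -
  obtain V \<phi> where c: "(V, \<phi>) \<in> A" "p \<in> V" by (rule chart_at)
  have "tangent_space A p = chart_vector V \<phi> p ` span Basis"
    using tangent_space_eq_range[OF c] by simp
  also have "\<dots> = span (chart_vector V \<phi> p ` Basis)"
    using linear_span_image[OF linear_chart_vector[OF c]] by simp
  finally have "B \<subseteq> span (chart_vector V \<phi> p ` Basis)" using assms(2) by simp
  from independent_span_bound[OF _ assms(1) this]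
  have "finite B" "card B \<le> card (chart_vector V \<phi> p ` (Basis :: 'b set))" by auto
  then show ?thesis using card_image_le[of Basis "chart_vector V \<phi> p"] by auto
qed

text \<open>Both the smoothness test and the derivative see only the germ at \<open>p\<close>; the
  default value 0 is taken by both functions or by neither.\<close>

lemma tangent_cong:
  assumes "v \<in> tangent_space A p" "open W" "p \<in> W" "\<And>q. q \<in> W \<Longrightarrow> h q = k q"
  shows "v h = v k"
proof -
  obtain V \<phi> where c: "(V, \<phi>) \<in> A" "p \<in> V" by (rule chart_at)
  then obtain w where v: "v = chart_vector V \<phi> p w" using tangent_space_eq_range assms(1) by blast
  have "((h \<circ> inv_into V \<phi>) has_derivative D) (at (\<phi> p)) \<longleftrightarrow>
      ((k \<circ> inv_into V \<phi>) has_derivative D) (at (\<phi> p))" for D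
  proof -
    have *: "((k \<circ> inv_into V \<phi>) has_derivative D) (at (\<phi> p))"
      if "((h \<circ> inv_into V \<phi>) has_derivative D) (at (\<phi> p))" "\<And>q. q \<in> W \<Longrightarrow> h q = k q" for h k
      by (rule has_derivative_transform_within_open[OF that(1) open_chart_image[OF c(1) assms(2)]])
        (use c assms(3) that(2) chart(4)[OF c(1)] in auto)
    show ?thesis using *[of h k] *[of k h] assms(4) by auto
  qed
  then show ?thesis
    using smooth_near_cong[OF assms(2-4)] by (simp add: v chart_vector_def frechet_derivative_def)
qed

lemma tangent_const: "v \<in> tangent_space A p \<Longrightarrow> v (\<lambda>q. a) = 0"
  unfolding tangent_space_def by (auto simp: o_def)

lemma tangent_add_mult:
  assumes "v \<in> tangent_space A p" "smooth_near A p h" "smooth_near A p k"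
  shows "v (\<lambda>q. h q + k q) = v h + v k"
    and "v (\<lambda>q. h q * k q) = v h * k p + h p * v k"
proof -
  obtain V \<phi> where c: "(V, \<phi>) \<in> A" "p \<in> V" by (rule chart_at)
  then obtain w where v: "v = chart_vector V \<phi> p w" using tangent_space_eq_range assms(1) by blast
  obtain W where W: "open W" "p \<in> W" "smooth_fun A W h" "smooth_fun A W k"
    using smooth_near_common assms(2,3) by blast
  have s: "smooth_near A p (\<lambda>q. h q + k q)" "smooth_near A p (\<lambda>q. h q * k q)"
    using smooth_fun_add smooth_fun_mult W smooth_nearI by blast+
  let ?h = "h \<circ> inv_into V \<phi>" and ?k = "k \<circ> inv_into V \<phi>"
  have h: "(?h has_derivative frechet_derivative ?h (at (\<phi> p))) (at (\<phi> p))"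
    and k: "(?k has_derivative frechet_derivative ?k (at (\<phi> p))) (at (\<phi> p))"
    using smooth_near_differentiable[OF assms(2) c] smooth_near_differentiable[OF assms(3) c]
    by (simp_all add: frechet_derivative_works[THEN iffD1])
  have e: "inv_into V \<phi> (\<phi> p) = p" using c chart(4)[OF c(1)] by simp
  have "frechet_derivative ((\<lambda>q. h q + k q) \<circ> inv_into V \<phi>) (at (\<phi> p)) w =
      frechet_derivative ?h (at (\<phi> p)) w + frechet_derivative ?k (at (\<phi> p)) w"
    using frechet_derivative_at[OF has_derivative_add[OF h k]] by (simp add: o_def fun_eq_iff)
  then show "v (\<lambda>q. h q + k q) = v h + v k"
    using s(1) assms(2,3) by (simp add: v chart_vector_def)
  have "frechet_derivative ((\<lambda>q. h q * k q) \<circ> inv_into V \<phi>) (at (\<phi> p)) w =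
      ?h (\<phi> p) * frechet_derivative ?k (at (\<phi> p)) w + frechet_derivative ?h (at (\<phi> p)) w * ?k (\<phi> p)"
    using frechet_derivative_at[OF has_derivative_mult[OF h k]] by (simp add: o_def fun_eq_iff)
  then show "v (\<lambda>q. h q * k q) = v h * k p + h p * v k"
    using s(2) assms(2,3) by (simp add: v chart_vector_def e)
qed

lemma tangent_eqI:
  assumes "v \<in> tangent_space A p" "v' \<in> tangent_space A p" "\<And>h. smooth_near A p h \<Longrightarrow> v h = v' h"
  shows "v = v'"
proof
  have "u h = 0" if "u \<in> tangent_space A p" "\<not> smooth_near A p h" for u h
    using that unfolding tangent_space_def by auto
  then show "v h = v' h" for h using assms by metis
qed

end


section \<open>Riemannian geometry over a fixed open set\<close>

locale riemannian_patch = manifold A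
  for A :: "('a::{t2_space, second_countable_topology}, 'b::euclidean_space) atlas" +
  fixes g :: "'a \<Rightarrow> 'a tangent \<Rightarrow> 'a tangent \<Rightarrow> real"
    and D :: "'a vfield \<Rightarrow> 'a vfield \<Rightarrow> 'a vfield"
    and U :: "'a set"
  assumes metric: "riemannian_metric A g"
    and levi_civita: "levi_civita A g D"
    and open_U [simp]: "open U"
begin

abbreviation T where "T p \<equiv> tangent_space A p"
abbreviation VF where "VF \<equiv> vector_field_on A U"
abbreviation SF where "SF \<equiv> smooth_fun A U"
abbreviation bracket where "bracket \<equiv> lie_bracket A"

lemma T_closed [simp]:
  "0 \<in> T p"
  "x \<in> T p \<Longrightarrow> y \<in> T p \<Longrightarrow> x + y \<in> T p"
  "x \<in> T p \<Longrightarrow> y \<in> T p \<Longrightarrow> x - y \<in> T p"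
  "x \<in> T p \<Longrightarrow> - x \<in> T p"
  "x \<in> T p \<Longrightarrow> a *\<^sub>R x \<in> T p"
  using subspace_tangent_space[of p]
  by (simp_all add: subspace_0 subspace_add subspace_diff subspace_neg subspace_scale)

lemma T_sum [simp]: "(\<And>i. i \<in> I \<Longrightarrow> x i \<in> T p) \<Longrightarrow> (\<Sum>i\<in>I. x i) \<in> T p"
  by (rule subspace_sum[OF subspace_tangent_space])


subsection \<open>Functions and vector fields on an open set\<close>

lemma SF_intros [simp]:
  "SF (\<lambda>q. a)"
  "SF h \<Longrightarrow> SF k \<Longrightarrow> SF (\<lambda>q. h q + k q)"
  "SF h \<Longrightarrow> SF k \<Longrightarrow> SF (\<lambda>q. h q - k q)"
  "SF h \<Longrightarrow> SF k \<Longrightarrow> SF (\<lambda>q. h q * k q)"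
  "SF h \<Longrightarrow> SF (\<lambda>q. - h q)"
  by (simp_all add: smooth_fun_const smooth_fun_add smooth_fun_diff smooth_fun_mult smooth_fun_minus)

lemma SF_sum [simp]: "(\<And>i. i \<in> I \<Longrightarrow> SF (h i)) \<Longrightarrow> SF (\<lambda>q. \<Sum>i\<in>I. h i q)"
  by (rule smooth_fun_sum[OF open_U])

lemma SF_near [simp]: "SF h \<Longrightarrow> p \<in> U \<Longrightarrow> smooth_near A p h"
  by (rule smooth_nearI[OF open_U])

lemma VF_T [simp]: "VF X \<Longrightarrow> p \<in> U \<Longrightarrow> X p \<in> T p"
  unfolding vector_field_on_def by blast

lemma vector_field_on_app:
  "vector_field_on A W X \<Longrightarrow> open V \<Longrightarrow> V \<subseteq> W \<Longrightarrow> smooth_fun A V h \<Longrightarrow> smooth_fun A V (\<lambda>p. X p h)"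
  unfolding vector_field_on_def by blast

lemma VF_app [simp]: "VF X \<Longrightarrow> SF h \<Longrightarrow> SF (\<lambda>p. X p h)"
  using vector_field_on_app[of U X U h] by simp

lemma VF_add [simp]:
  assumes "VF X" "VF Y"
  shows "VF (\<lambda>q. X q + Y q)"
  unfolding vector_field_on_def
proof (intro conjI ballI allI impI)
  fix V k assume V: "open V \<and> V \<subseteq> U \<and> smooth_fun A V k"
  show "smooth_fun A V (\<lambda>p. (X p + Y p) k)"
    unfolding plus_fun_def
    by (rule smooth_fun_add) (use V assms vector_field_on_app in auto)
qed (use assms in simp)

lemma VF_scale [simp]:
  assumes "SF h" "VF X"
  shows "VF (\<lambda>q. h q *\<^sub>R X q)"
  unfolding vector_field_on_def
proof (intro conjI ballI allI impI)
  fix V k assume V: "open V \<and> V \<subseteq> U \<and> smooth_fun A V k"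
  show "smooth_fun A V (\<lambda>p. (h p *\<^sub>R X p) k)"
    unfolding scaleR_fun_def real_scaleR_def
    by (rule smooth_fun_mult) (use V assms smooth_fun_subset vector_field_on_app in auto)
qed (use assms in simp)

lemma VF_0 [simp]: "VF (\<lambda>q. 0)"
  unfolding vector_field_on_def by (simp add: smooth_fun_const)

lemma VF_cscale [simp]: "VF X \<Longrightarrow> VF (\<lambda>q. a *\<^sub>R X q)"
  using VF_scale[of "\<lambda>q. a" X] by simp

lemma VF_minus [simp]: "VF X \<Longrightarrow> VF (\<lambda>q. - X q)"
  using VF_cscale[of X "-1"] by simp

lemma VF_diff [simp]: "VF X \<Longrightarrow> VF Y \<Longrightarrow> VF (\<lambda>q. X q - Y q)"
  using VF_add[of X "\<lambda>q. - Y q"] by simp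

lemma VF_sum [simp]: "(\<And>i. i \<in> I \<Longrightarrow> VF (X i)) \<Longrightarrow> VF (\<lambda>q. \<Sum>i\<in>I. X i q)"
  by (induction I rule: infinite_finite_induct) simp_all

lemma der_cong:
  "VF X \<Longrightarrow> p \<in> U \<Longrightarrow> (\<And>q. q \<in> U \<Longrightarrow> h q = k q) \<Longrightarrow> X p h = X p k"
  using tangent_cong[OF VF_T open_U] .

lemma der_simps:
  assumes "VF X" "p \<in> U"
  shows "X p (\<lambda>q. a) = 0"
    and "SF h \<Longrightarrow> SF k \<Longrightarrow> X p (\<lambda>q. h q + k q) = X p h + X p k"
    and "SF h \<Longrightarrow> SF k \<Longrightarrow> X p (\<lambda>q. h q * k q) = X p h * k p + h p * X p k"
    and "SF h \<Longrightarrow> X p (\<lambda>q. - h q) = - X p h"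
    and "SF h \<Longrightarrow> SF k \<Longrightarrow> X p (\<lambda>q. h q - k q) = X p h - X p k"
proof -
  note x = VF_T[OF assms]
  let ?x = "X p"
  show c: "?x (\<lambda>q. a) = 0" for a by (rule tangent_const[OF x])
  show a: "?x (\<lambda>q. h q + k q) = ?x h + ?x k" if "SF h" "SF k" for h k
    using tangent_add_mult(1)[OF x] that assms(2) by simp
  show "SF h \<Longrightarrow> SF k \<Longrightarrow> ?x (\<lambda>q. h q * k q) = ?x h * k p + h p * ?x k"
    using tangent_add_mult(2)[OF x] assms(2) by simp
  show m: "?x (\<lambda>q. - h q) = - ?x h" if "SF h" for h
    using a[of h "\<lambda>q. - h q"] c[of 0] that by simp
  show "SF h \<Longrightarrow> SF k \<Longrightarrow> ?x (\<lambda>q. h q - k q) = ?x h - ?x k"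
    using a[of h "\<lambda>q. - k q"] m[of k] by simp
qed

lemma der_sum:
  assumes "VF X" "p \<in> U" "\<And>i. i \<in> I \<Longrightarrow> SF (h i)"
  shows "X p (\<lambda>q. \<Sum>i\<in>I. h i q) = (\<Sum>i\<in>I. X p (h i))"
  using assms(3)
  by (induction I rule: infinite_finite_induct) (simp_all add: der_simps[OF assms(1,2)])


subsection \<open>The metric\<close>

lemmas metric_conjs =
  metric[unfolded riemannian_metric_def, THEN conjunct1]
  metric[unfolded riemannian_metric_def, THEN conjunct2, THEN conjunct1]
  metric[unfolded riemannian_metric_def, THEN conjunct2, THEN conjunct2, THEN conjunct1]
  metric[unfolded riemannian_metric_def, THEN conjunct2, THEN conjunct2, THEN conjunct2]

lemma g_sym: "x \<in> T p \<Longrightarrow> y \<in> T p \<Longrightarrow> g p x y = g p y x"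
  using metric_conjs(1) by simp

lemma g_lin: "x \<in> T p \<Longrightarrow> y \<in> T p \<Longrightarrow> z \<in> T p \<Longrightarrow>
    g p (a *\<^sub>R x + b *\<^sub>R y) z = a * g p x z + b * g p y z"
  using metric_conjs(2) by simp

lemma g_left [simp]:
  "x \<in> T p \<Longrightarrow> y \<in> T p \<Longrightarrow> z \<in> T p \<Longrightarrow> g p (x + y) z = g p x z + g p y z"
  "x \<in> T p \<Longrightarrow> z \<in> T p \<Longrightarrow> g p (a *\<^sub>R x) z = a * g p x z"
  "z \<in> T p \<Longrightarrow> g p 0 z = 0"
  "x \<in> T p \<Longrightarrow> z \<in> T p \<Longrightarrow> g p (- x) z = - g p x z"
  "x \<in> T p \<Longrightarrow> y \<in> T p \<Longrightarrow> z \<in> T p \<Longrightarrow> g p (x - y) z = g p x z - g p y z"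
proof -
  show add: "g p (x + y) z = g p x z + g p y z" if "x \<in> T p" "y \<in> T p" "z \<in> T p" for x y
    using g_lin[OF that, of 1 1] by simp
  show scale: "g p (a *\<^sub>R x) z = a * g p x z" if "x \<in> T p" "z \<in> T p" for a x
    using g_lin[OF that(1) that(1) that(2), of a 0] by simp
  show "g p 0 z = 0" if "z \<in> T p"
    using scale[of 0 0] that by simp
  show minus: "g p (- x) z = - g p x z" if "x \<in> T p" "z \<in> T p" for x
    using scale[OF that, of "-1"] by simp
  show "g p (x - y) z = g p x z - g p y z" if "x \<in> T p" "y \<in> T p" "z \<in> T p"
    using add[OF that(1) T_closed(4)[OF that(2)] that(3)] minus[OF that(2,3)] by simp
qed

lemma g_right [simp]:
  "x \<in> T p \<Longrightarrow> y \<in> T p \<Longrightarrow> z \<in> T p \<Longrightarrow> g p z (x + y) = g p z x + g p z y"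
  "x \<in> T p \<Longrightarrow> z \<in> T p \<Longrightarrow> g p z (a *\<^sub>R x) = a * g p z x"
  "z \<in> T p \<Longrightarrow> g p z 0 = 0"
  "x \<in> T p \<Longrightarrow> z \<in> T p \<Longrightarrow> g p z (- x) = - g p z x"
  "x \<in> T p \<Longrightarrow> y \<in> T p \<Longrightarrow> z \<in> T p \<Longrightarrow> g p z (x - y) = g p z x - g p z y"
  by (simp_all add: g_sym[of z p])

lemma g_sum_left: "(\<And>i. i \<in> I \<Longrightarrow> x i \<in> T p) \<Longrightarrow> z \<in> T p \<Longrightarrow>
    g p (\<Sum>i\<in>I. x i) z = (\<Sum>i\<in>I. g p (x i) z)"
  by (induction I rule: infinite_finite_induct) simp_all

lemma g_sum_right: "(\<And>i. i \<in> I \<Longrightarrow> x i \<in> T p) \<Longrightarrow> z \<in> T p \<Longrightarrow>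
    g p z (\<Sum>i\<in>I. x i) = (\<Sum>i\<in>I. g p z (x i))"
  by (induction I rule: infinite_finite_induct) simp_all

lemma g_pos: "x \<in> T p \<Longrightarrow> x \<noteq> 0 \<Longrightarrow> g p x x > 0"
  using metric_conjs(3) by simp

lemma g_eq_0 [simp]: "x \<in> T p \<Longrightarrow> g p x x = 0 \<longleftrightarrow> x = 0"
  by (metis g_pos g_left(3) less_irrefl)

lemma SF_g [simp]: "VF X \<Longrightarrow> VF Y \<Longrightarrow> SF (\<lambda>p. g p (X p) (Y p))"
  using metric_conjs(4) by simp

text \<open>The difference of the two fields is itself an admissible test field, and g is positive
  definite at \<open>p\<close>.\<close>

lemma field_eqI:
  assumes "VF X" "VF Y" "p \<in> U" "\<And>Z. VF Z \<Longrightarrow> g p (X p) (Z p) = g p (Y p) (Z p)"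
  shows "X p = Y p"
proof -
  have "g p (X p) (X p - Y p) = g p (Y p) (X p - Y p)"
    using assms(4)[of "\<lambda>q. X q - Y q"] assms by simp
  then have "g p (X p - Y p) (X p - Y p) = 0" using assms by simp
  then show ?thesis using assms g_eq_0[of "X p - Y p" p] by simp
qed


subsection \<open>The Levi-Civita connection\<close>

lemma connection: "linear_connection A D"
  using levi_civita unfolding levi_civita_def by blast

lemmas connection_conjs =
  connection[unfolded linear_connection_def, THEN conjunct1]
  connection[unfolded linear_connection_def, THEN conjunct2, THEN conjunct1]
  connection[unfolded linear_connection_def, THEN conjunct2, THEN conjunct2, THEN conjunct1]
  connection[unfolded linear_connection_def, THEN conjunct2, THEN conjunct2, THEN conjunct2,
    THEN conjunct1]
  connection[unfolded linear_connection_def, THEN conjunct2, THEN conjunct2, THEN conjunct2,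
    THEN conjunct2, THEN conjunct1]
  connection[unfolded linear_connection_def, THEN conjunct2, THEN conjunct2, THEN conjunct2,
    THEN conjunct2, THEN conjunct2]

lemma VF_D [simp]: "VF X \<Longrightarrow> VF Y \<Longrightarrow> VF (D X Y)"
  using connection_conjs(1)[rule_format, of U] by simp

lemma D_scale_left: "SF h \<Longrightarrow> VF X \<Longrightarrow> VF Y \<Longrightarrow> p \<in> U \<Longrightarrow>
    D (\<lambda>q. h q *\<^sub>R X q) Y p = h p *\<^sub>R D X Y p"
  using connection_conjs(3)[rule_format, of U] by simp

lemma D_add_right: "VF X \<Longrightarrow> VF Y \<Longrightarrow> VF Y' \<Longrightarrow> p \<in> U \<Longrightarrow>
    D X (\<lambda>q. Y q + Y' q) p = D X Y p + D X Y' p"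
  using connection_conjs(4)[rule_format, of U] by simp

lemma D_scale_right: "SF h \<Longrightarrow> VF X \<Longrightarrow> VF Y \<Longrightarrow> p \<in> U \<Longrightarrow>
    D X (\<lambda>q. h q *\<^sub>R Y q) p = X p h *\<^sub>R Y p + h p *\<^sub>R D X Y p"
  using connection_conjs(5)[rule_format, of U] by simp

lemma D_cong: "VF X \<Longrightarrow> VF X' \<Longrightarrow> VF Y \<Longrightarrow> VF Y' \<Longrightarrow> (\<And>q. q \<in> U \<Longrightarrow> X q = X' q) \<Longrightarrow>
    (\<And>q. q \<in> U \<Longrightarrow> Y q = Y' q) \<Longrightarrow> p \<in> U \<Longrightarrow> D X Y p = D X' Y' p"
  using connection_conjs(6)[rule_format, of U X X' Y Y' p] by simp

lemma D_minus_left: "VF X \<Longrightarrow> VF Y \<Longrightarrow> p \<in> U \<Longrightarrow> D (\<lambda>q. - X q) Y p = - D X Y p"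
  using D_scale_left[of "\<lambda>q. -1" X Y p] by simp

lemma D_minus_right: "VF X \<Longrightarrow> VF Y \<Longrightarrow> p \<in> U \<Longrightarrow> D X (\<lambda>q. - Y q) p = - D X Y p"
  using D_scale_right[of "\<lambda>q. -1" X Y p] der_simps(1)[of X p] by simp

lemma D_diff_right: "VF X \<Longrightarrow> VF Y \<Longrightarrow> VF Y' \<Longrightarrow> p \<in> U \<Longrightarrow>
    D X (\<lambda>q. Y q - Y' q) p = D X Y p - D X Y' p"
  using D_add_right[of X Y "\<lambda>q. - Y' q" p] D_minus_right[of X Y' p] by simp

lemma D_zero: "VF X \<Longrightarrow> p \<in> U \<Longrightarrow> D (\<lambda>q. 0) X p = 0" "VF X \<Longrightarrow> p \<in> U \<Longrightarrow> D X (\<lambda>q. 0) p = 0"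
  using D_scale_left[of "\<lambda>q. 0" X X p] D_scale_right[of "\<lambda>q. 0" X X p] der_simps(1)[of X p]
  by simp_all

lemma D_sum_right: "(\<And>i. i \<in> I \<Longrightarrow> VF (Y i)) \<Longrightarrow> VF X \<Longrightarrow> p \<in> U \<Longrightarrow>
    D X (\<lambda>q. \<Sum>i\<in>I. Y i q) p = (\<Sum>i\<in>I. D X (Y i) p)"
  by (induction I rule: infinite_finite_induct) (simp_all add: D_zero D_add_right)

lemma bracket_eq: "VF X \<Longrightarrow> VF Y \<Longrightarrow> p \<in> U \<Longrightarrow> bracket X Y p = D X Y p - D Y X p"
  using levi_civita[unfolded levi_civita_def, THEN conjunct2, THEN conjunct1, rule_format, of U] by simp

lemma D_metric: "VF X \<Longrightarrow> VF Y \<Longrightarrow> VF Z \<Longrightarrow> p \<in> U \<Longrightarrow>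
    X p (\<lambda>q. g q (Y q) (Z q)) = g p (D X Y p) (Z p) + g p (Y p) (D X Z p)"
  using levi_civita[unfolded levi_civita_def, THEN conjunct2, THEN conjunct2, rule_format, of U] by simp

lemma VF_cong:
  assumes "\<And>q. q \<in> U \<Longrightarrow> X q = Y q" "VF X"
  shows "VF Y"
  unfolding vector_field_on_def
proof (intro conjI ballI allI impI)
  fix V h assume V: "open V \<and> V \<subseteq> U \<and> smooth_fun A V h"
  show "smooth_fun A V (\<lambda>p. Y p h)"
    by (rule smooth_fun_cong[of V "\<lambda>p. X p h"]) (use V assms vector_field_on_app in auto)
next
  fix p assume "p \<in> U"
  then show "Y p \<in> T p" using VF_T[OF assms(2)] assms(1) by auto
qed

text \<open>Vanishing torsion writes the bracket as a difference of covariant derivatives, whose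
  smoothness is part of \<open>linear_connection\<close>.\<close>

lemma VF_bracket [simp]: "VF X \<Longrightarrow> VF Y \<Longrightarrow> VF (bracket X Y)"
  by (rule VF_cong[of "\<lambda>q. D X Y q - D Y X q"]) (simp_all add: bracket_eq)

lemma bracket_app: "SF h \<Longrightarrow> p \<in> U \<Longrightarrow> bracket X Y p h = X p (\<lambda>q. Y q h) - Y p (\<lambda>q. X q h)"
  by (simp add: lie_bracket_def)

lemma bracket_skew: "bracket Y X p = - bracket X Y p"
  by (auto simp: lie_bracket_def)

text \<open>Applied to a function, the three double brackets give twelve threefold derivatives that
  cancel in pairs.\<close>

lemma jacobi:
  assumes "VF X" "VF Y" "VF Z" "p \<in> U"
  shows "bracket X (bracket Y Z) p + bracket Y (bracket Z X) p + bracket Z (bracket X Y) p = 0"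
proof (rule tangent_eqI)
  fix h assume "smooth_near A p h"
  then obtain W where W: "open W" "p \<in> W" "smooth_fun A W h" unfolding smooth_near_def by blast
  \<comment> \<open>The function \<open>h\<close> is smooth only near \<open>p\<close>; over the
    smaller set its derivatives are smooth as well, so they may be subtracted term by term.\<close>
  interpret W: riemannian_patch A g D "U \<inter> W"
    by unfold_locales (use metric levi_civita W in auto)
  have VF': "W.VF V" if "VF V" for V
    using that unfolding vector_field_on_def by auto
  have h [simp]: "W.SF h" by (rule smooth_fun_subset[OF W(3)]) simp
  note v [simp] = assms(1-3)[THEN VF']
  have p: "p \<in> U \<inter> W" using assms W by simp
  have *: "bracket X' (bracket Y' Z') p h = X' p (\<lambda>q. Y' q (\<lambda>r. Z' r h)) - X' p (\<lambda>q. Z' q (\<lambda>r. Y' r h))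
      - (Y' p (\<lambda>r. Z' r (\<lambda>q. X' q h)) - Z' p (\<lambda>r. Y' r (\<lambda>q. X' q h)))"
    if [simp]: "W.VF X'" "W.VF Y'" "W.VF Z'" for X' Y' Z'
  proof -
    have "X' p (\<lambda>q. bracket Y' Z' q h) = X' p (\<lambda>q. Y' q (\<lambda>r. Z' r h) - Z' q (\<lambda>r. Y' r h))"
      by (rule W.der_cong[of X', OF _ p]) (use p in \<open>simp_all add: W.bracket_app\<close>)
    also have "\<dots> = X' p (\<lambda>q. Y' q (\<lambda>r. Z' r h)) - X' p (\<lambda>q. Z' q (\<lambda>r. Y' r h))"
      by (rule W.der_simps(5)[of X', OF _ p]) (use p in \<open>simp_all\<close>)
    finally show ?thesis using p by (simp add: W.bracket_app del: Int_iff)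
  qed
  show "(bracket X (bracket Y Z) p + bracket Y (bracket Z X) p + bracket Z (bracket X Y) p) h =
      (0 :: 'a tangent) h"
    by (simp add: *)
qed (use assms in simp_all)


subsection \<open>The curvature tensor\<close>

definition Rm :: "'a vfield \<Rightarrow> 'a vfield \<Rightarrow> 'a vfield \<Rightarrow> 'a vfield \<Rightarrow> 'a \<Rightarrow> real" where
  "Rm X Y Z W p = g p (curvature A D X Y Z p) (W p)"

lemma VF_curvature [simp]: "VF X \<Longrightarrow> VF Y \<Longrightarrow> VF Z \<Longrightarrow> VF (curvature A D X Y Z)"
  unfolding curvature_def by simp

lemma Rm_eq:
  assumes "VF X" "VF Y" "VF Z" "VF W" "p \<in> U"
  shows "Rm X Y Z W p = g p (D X (D Y Z) p) (W p) - g p (D Y (D X Z) p) (W p)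
    - g p (D (bracket X Y) Z p) (W p)"
  using assms by (simp add: Rm_def curvature_def)

lemma Rm_skew12:
  assumes "VF X" "VF Y" "VF Z" "VF W" "p \<in> U"
  shows "Rm Y X Z W p = - Rm X Y Z W p"
proof -
  have "D (bracket Y X) Z p = D (\<lambda>q. - bracket X Y q) Z p"
    by (rule D_cong) (simp_all add: assms bracket_skew[of X Y])
  then have "D (bracket Y X) Z p = - D (bracket X Y) Z p"
    using assms by (simp add: D_minus_left)
  then show ?thesis using assms by (simp add: Rm_eq)
qed

text \<open>Second derivatives of the function g(Z,W) along X and Y commute up to the derivative
  along the bracket. Expanding all of them by metric compatibility leaves exactly the skewness of
  R(X,Y).\<close>

lemma Rm_skew34:
  assumes [simp]: "VF X" "VF Y" "VF Z" "VF W" "p \<in> U"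
  shows "Rm X Y W Z p = - Rm X Y Z W p"
proof -
  let ?h = "\<lambda>q. g q (Z q) (W q)"
  have *: "X' p (\<lambda>q. Y' q ?h) = g p (D X' (D Y' Z) p) (W p) + g p (D Y' Z p) (D X' W p)
      + (g p (D X' Z p) (D Y' W p) + g p (Z p) (D X' (D Y' W) p))"
    if [simp]: "VF X'" "VF Y'" for X' Y'
  proof -
    have "X' p (\<lambda>q. Y' q ?h) = X' p (\<lambda>q. g q (D Y' Z q) (W q) + g q (Z q) (D Y' W q))"
      by (rule der_cong[of X']) (simp_all add: D_metric)
    then show ?thesis by (simp add: der_simps(2)[of X'] D_metric[of X'])
  qed
  have "bracket X Y p ?h = g p (D (bracket X Y) Z p) (W p) + g p (Z p) (D (bracket X Y) W p)"
    by (simp add: D_metric)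
  moreover have "bracket X Y p ?h = X p (\<lambda>q. Y q ?h) - Y p (\<lambda>q. X q ?h)"
    by (simp add: bracket_app)
  ultimately show ?thesis
    by (simp add: Rm_eq * g_sym[of "Z p"])
qed

text \<open>Vanishing torsion turns the cyclic sum of curvatures into the Jacobi sum of double
  brackets.\<close>

lemma Rm_bianchi:
  assumes [simp]: "VF X" "VF Y" "VF Z" "VF W" "p \<in> U"
  shows "Rm X Y Z W p + Rm Y Z X W p + Rm Z X Y W p = 0"
proof -
  have *: "D X' (D Y' Z') p - D X' (D Z' Y') p - D (bracket Y' Z') X' p = bracket X' (bracket Y' Z') p"
    if [simp]: "VF X'" "VF Y'" "VF Z'" for X' Y' Z'
  proof -
    have "D X' (bracket Y' Z') p = D X' (\<lambda>q. D Y' Z' q - D Z' Y' q) p"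
      by (rule D_cong) (simp_all add: bracket_eq)
    then show ?thesis by (simp add: D_diff_right bracket_eq[of X'])
  qed
  have "curvature A D X Y Z p + curvature A D Y Z X p + curvature A D Z X Y p =
      bracket X (bracket Y Z) p + bracket Y (bracket Z X) p + bracket Z (bracket X Y) p"
    unfolding *[symmetric, OF assms(1,2,3)] *[symmetric, OF assms(2,3,1)] *[symmetric, OF assms(3,1,2)]
    by (simp add: curvature_def algebra_simps)
  then have "curvature A D X Y Z p + curvature A D Y Z X p + curvature A D Z X Y p = 0"
    using jacobi[OF assms(1-3,5)] by simp
  then have "g p (curvature A D X Y Z p + curvature A D Y Z X p + curvature A D Z X Y p) (W p) = 0"
    by simp
  then show ?thesis by (simp add: Rm_def)
qed

text \<open>A linear combination of the Bianchi identities for the four cyclic rotations of the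
  arguments, after the skew symmetries have matched their terms.\<close>

lemma Rm_pair:
  assumes "VF X" "VF Y" "VF Z" "VF W" "p \<in> U"
  shows "Rm X Y Z W p = Rm Z W X Y p"
proof -
  note b = Rm_bianchi and s = Rm_skew12 and t = Rm_skew34
  note v = assms
  show ?thesis
    using b[OF v(1,2,3,4,5)] b[OF v(2,3,4,1,5)] b[OF v(3,4,1,2,5)] b[OF v(4,1,2,3,5)]
      t[OF v(1,2,3,4,5)] t[OF v(2,3,4,1,5)] t[OF v(3,4,1,2,5)] t[OF v(4,1,2,3,5)]
      s[OF v(1,3,2,4,5)] s[OF v(1,3,4,2,5)] s[OF v(2,4,1,3,5)] s[OF v(2,4,3,1,5)]
      t[OF v(1,3,2,4,5)] t[OF v(2,4,1,3,5)]
      t[OF v(3,1,2,4,5)] t[OF v(4,2,1,3,5)]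
    by linarith
qed

end


text \<open>The Jacobi identity as a product rule for the Lie derivative along X; in this form it
  makes Lie and exterior derivative commute in \<open>xi_fundamental_form\<close>.\<close>

lemma (in riemannian_patch) leibniz_bracket:
  assumes [simp]: "VF X" "VF Y" "VF Z" "p \<in> U"
  shows "bracket X (bracket Y Z) p = bracket (bracket X Y) Z p + bracket Y (bracket X Z) p"
proof -
  have "bracket Z X = (\<lambda>q. - bracket X Z q)" using bracket_skew by blast
  then have "bracket Y (bracket Z X) p = - bracket Y (bracket X Z) p"
    by (simp add: bracket_eq D_minus_left D_minus_right)
  moreover have "bracket Z (bracket X Y) p = - bracket (bracket X Y) Z p"
    by (rule bracket_skew)
  ultimately show ?thesis
    using jacobi[OF assms] by (simp add: algebra_simps)
qed

section \<open>Pointwise algebra of the structure tensors\<close>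

locale S_patch = riemannian_patch A g D U
  for A :: "('a::{t2_space, second_countable_topology}, 'b::euclidean_space) atlas"
    and g D U +
  fixes n s :: nat
    and f :: "'a \<Rightarrow> 'a tangent \<Rightarrow> 'a tangent"
    and \<xi> :: "nat \<Rightarrow> 'a vfield"
    and \<eta> :: "nat \<Rightarrow> 'a \<Rightarrow> 'a tangent \<Rightarrow> real"
  assumes S_manifold: "S_manifold A n s f \<xi> \<eta> g"
begin

text \<open>A constant, so that the simplifier does not rewrite membership in the index set.\<close>

definition I where "I = {1..s}"

lemma finite_I [simp]: "finite I" and card_I [simp]: "card I = s"
  by (simp_all add: I_def)

lemma metric_f: "metric_f_manifold A n s f \<xi> \<eta> g"
  using S_manifold unfolding S_manifold_def by blast

lemma dims: "1 \<le> n" "1 \<le> s" "DIM('b) = 2 * n + s"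
  using metric_f unfolding metric_f_manifold_def by simp_all

lemma tensor_f: "tensor_field_1_1 A f"
  using metric_f unfolding metric_f_manifold_def by simp

lemma f_T [simp]: "x \<in> T p \<Longrightarrow> f p x \<in> T p"
  using tensor_f[unfolded tensor_field_1_1_def, THEN conjunct1] by simp

lemma f_simps [simp]:
  "x \<in> T p \<Longrightarrow> y \<in> T p \<Longrightarrow> f p (x + y) = f p x + f p y"
  "x \<in> T p \<Longrightarrow> f p (a *\<^sub>R x) = a *\<^sub>R f p x"
  "f p 0 = 0"
  "x \<in> T p \<Longrightarrow> f p (- x) = - f p x"
  "x \<in> T p \<Longrightarrow> y \<in> T p \<Longrightarrow> f p (x - y) = f p x - f p y"
proof -
  have lin: "f p (a *\<^sub>R x + b *\<^sub>R y) = a *\<^sub>R f p x + b *\<^sub>R f p y" if "x \<in> T p" "y \<in> T p" for x y a b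
    using tensor_f[unfolded tensor_field_1_1_def, THEN conjunct2, THEN conjunct1] that by blast
  show "x \<in> T p \<Longrightarrow> y \<in> T p \<Longrightarrow> f p (x + y) = f p x + f p y"
    using lin[of x y 1 1] by simp
  show "x \<in> T p \<Longrightarrow> f p (a *\<^sub>R x) = a *\<^sub>R f p x"
    using lin[of x x a 0] by simp
  show "f p 0 = 0"
    using lin[of 0 0 0 0] by simp
  show "x \<in> T p \<Longrightarrow> f p (- x) = - f p x"
    using lin[of x x "-1" 0] by simp
  show "x \<in> T p \<Longrightarrow> y \<in> T p \<Longrightarrow> f p (x - y) = f p x - f p y"
    using lin[of x y 1 "-1"] by simp
qed

lemma f_sum: "(\<And>i. i \<in> J \<Longrightarrow> x i \<in> T p) \<Longrightarrow> f p (\<Sum>i\<in>J. x i) = (\<Sum>i\<in>J. f p (x i))"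
  by (induction J rule: infinite_finite_induct) simp_all

lemma VF_f [simp]: "VF X \<Longrightarrow> VF (\<lambda>q. f q (X q))"
  using tensor_f[unfolded tensor_field_1_1_def, THEN conjunct2, THEN conjunct2, rule_format, of U X] by simp

lemma VF_xi [simp]: "\<alpha> \<in> I \<Longrightarrow> VF (\<xi> \<alpha>)"
  using metric_f unfolding metric_f_manifold_def vector_field_on_def by (simp add: I_def)

lemma xi_T [simp]: "\<alpha> \<in> I \<Longrightarrow> \<xi> \<alpha> p \<in> T p"
  using metric_f unfolding metric_f_manifold_def vector_field_on_def by (simp add: I_def)

lemma eta_eq: "\<alpha> \<in> I \<Longrightarrow> x \<in> T p \<Longrightarrow> \<eta> \<alpha> p x = g p x (\<xi> \<alpha> p)"
  using metric_f unfolding metric_f_manifold_def by (simp add: I_def)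

lemma f_f:
  assumes "x \<in> T p"
  shows "f p (f p x) = - x + (\<Sum>\<alpha>\<in>I. g p x (\<xi> \<alpha> p) *\<^sub>R \<xi> \<alpha> p)"
proof -
  have "f p (f p x) = - x + (\<Sum>\<alpha>\<in>I. \<eta> \<alpha> p x *\<^sub>R \<xi> \<alpha> p)"
    using metric_f assms unfolding metric_f_manifold_def I_def by simp
  also have "(\<Sum>\<alpha>\<in>I. \<eta> \<alpha> p x *\<^sub>R \<xi> \<alpha> p) = (\<Sum>\<alpha>\<in>I. g p x (\<xi> \<alpha> p) *\<^sub>R \<xi> \<alpha> p)"
    by (rule sum.cong) (simp_all add: eta_eq assms)
  finally show ?thesis .
qed

lemma xi_xi: "\<alpha> \<in> I \<Longrightarrow> \<beta> \<in> I \<Longrightarrow> g p (\<xi> \<alpha> p) (\<xi> \<beta> p) = (if \<alpha> = \<beta> then 1 else 0)"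
  using metric_f eta_eq[of \<beta> "\<xi> \<alpha> p" p] unfolding metric_f_manifold_def by (auto simp: I_def)

lemma f_xi [simp]: "\<alpha> \<in> I \<Longrightarrow> f p (\<xi> \<alpha> p) = 0"
  using metric_f unfolding metric_f_manifold_def by (simp add: I_def)

lemma g_f [simp]: "x \<in> T p \<Longrightarrow> y \<in> T p \<Longrightarrow> g p (f p x) y = - g p x (f p y)"
  using metric_f unfolding metric_f_manifold_def by simp

lemma xi_f [simp]: "\<alpha> \<in> I \<Longrightarrow> x \<in> T p \<Longrightarrow> g p (\<xi> \<alpha> p) (f p x) = 0"
  using g_f[of "\<xi> \<alpha> p" p x] by simp

lemma g_f_skew: "x \<in> T p \<Longrightarrow> y \<in> T p \<Longrightarrow> g p y (f p x) = - g p x (f p y)"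
  using g_f[of x p y] g_sym[of y p "f p x"] by simp

text \<open>The metric dual of the sum of the forms \<open>\<eta> \<alpha>\<close>. The number s
  enters the curvature identities through \<open>xib_xib\<close> and \<open>D_xib\<close>.\<close>

definition xib :: "'a vfield" where "xib q = (\<Sum>\<alpha>\<in>I. \<xi> \<alpha> q)"

lemma VF_xib [simp]: "VF xib"
  using VF_sum[of I \<xi>] by (simp add: xib_def[abs_def])

lemma xib_T [simp]: "xib p \<in> T p"
  by (simp add: xib_def)

lemma f_xib [simp]: "f p (xib p) = 0"
  by (simp add: xib_def f_sum)

lemma g_xib: "x \<in> T p \<Longrightarrow> g p x (xib p) = (\<Sum>\<alpha>\<in>I. g p x (\<xi> \<alpha> p))"
  by (simp add: xib_def g_sum_right)

lemma xib_xib: "g p (xib p) (xib p) = real s"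
proof -
  have "g p (xib p) (\<xi> \<alpha> p) = 1" if "\<alpha> \<in> I" for \<alpha>
    using that by (simp add: xib_def g_sum_left xi_xi)
  then show ?thesis by (simp add: g_xib)
qed

lemma xib_f [simp]: "x \<in> T p \<Longrightarrow> g p (xib p) (f p x) = 0"
  using g_f[of "xib p" p x] by simp


subsection \<open>The structure vector fields are Killing\<close>

lemma fundamental_form_eq:
  assumes [simp]: "VF X" "VF Y" "p \<in> U" "\<alpha> \<in> I"
  shows "d_form A (\<eta> \<alpha>) X Y p = g p (X p) (f p (Y p))"
    and "2 * g p (X p) (f p (Y p)) = X p (\<lambda>q. g q (Y q) (\<xi> \<alpha> q)) - Y p (\<lambda>q. g q (X q) (\<xi> \<alpha> q))
      - g p (bracket X Y p) (\<xi> \<alpha> p)"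
proof -
  have "\<forall>U X Y. open U \<and> vector_field_on A U X \<and> vector_field_on A U Y \<longrightarrow>
      (\<forall>p\<in>U. fundamental_form f g X Y p = d_form A (\<eta> \<alpha>) X Y p)"
    using S_manifold assms(4) unfolding S_manifold_def I_def by simp
  then have "fundamental_form f g X Y p = d_form A (\<eta> \<alpha>) X Y p"
    using assms(1-3) open_U by blast
  then show *: "d_form A (\<eta> \<alpha>) X Y p = g p (X p) (f p (Y p))"
    by (simp add: fundamental_form_def)
  have "X p (\<lambda>q. \<eta> \<alpha> q (Y q)) = X p (\<lambda>q. g q (Y q) (\<xi> \<alpha> q))"
    "Y p (\<lambda>q. \<eta> \<alpha> q (X q)) = Y p (\<lambda>q. g q (X q) (\<xi> \<alpha> q))"
    by (rule der_cong[of X] der_cong[of Y]; simp add: eta_eq)+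
  then show "2 * g p (X p) (f p (Y p)) = X p (\<lambda>q. g q (Y q) (\<xi> \<alpha> q)) - Y p (\<lambda>q. g q (X q) (\<xi> \<alpha> q))
      - g p (bracket X Y p) (\<xi> \<alpha> p)"
    using * by (simp add: d_form_def eta_eq)
qed

text \<open>All the forms d\<eta> coincide with \<Phi>, so the sum in the normality condition
  collapses to a multiple of \<open>xib\<close>.\<close>

lemma normality:
  assumes [simp]: "VF X" "VF Y" "p \<in> U"
  shows "nijenhuis A f X Y p = (- 2 * g p (X p) (f p (Y p))) *\<^sub>R xib p"
proof -
  have "nijenhuis A f X Y p + 2 *\<^sub>R (\<Sum>\<alpha>\<in>I. d_form A (\<eta> \<alpha>) X Y p *\<^sub>R \<xi> \<alpha> p) = 0"
    using S_manifold[unfolded S_manifold_def, THEN conjunct2, THEN conjunct1, rule_format, of U X Y p]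
    by (simp add: I_def)
  then show ?thesis
    by (simp add: fundamental_form_eq(1) xib_def scaleR_sum_right[symmetric] add_eq_0_iff2)
qed

text \<open>The Lie derivative of \<open>\<eta> \<beta>\<close> along \<open>\<xi> \<alpha>\<close>
  is zero: \<Phi> vanishes on \<open>\<xi> \<alpha>\<close> and \<eta>(\<xi>) is constant, so only
  two terms of d\<eta> survive and must be equal.\<close>

lemma xi_der:
  assumes [simp]: "VF X" "p \<in> U" "\<alpha> \<in> I" "\<beta> \<in> I"
  shows "\<xi> \<alpha> p (\<lambda>q. g q (X q) (\<xi> \<beta> q)) = g p (bracket (\<xi> \<alpha>) X p) (\<xi> \<beta> p)"
proof -
  have "X p (\<lambda>q. g q (\<xi> \<alpha> q) (\<xi> \<beta> q)) = 0"
    using der_simps(1)[of X p] by (simp add: xi_xi)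
  then show ?thesis
    using fundamental_form_eq(2)[of "\<xi> \<alpha>" X p \<beta>] by simp
qed

text \<open>The Lie derivative of f along \<open>\<xi> \<alpha>\<close> is zero. Normality yields
  this only after one more application of f. The kernel of f is spanned by the structure fields, and
  \<open>xi_der\<close> shows that the difference has no component along them.\<close>

lemma xi_bracket_f:
  assumes [simp]: "VF X" "p \<in> U" "\<alpha> \<in> I"
  shows "bracket (\<xi> \<alpha>) (\<lambda>q. f q (X q)) p = f p (bracket (\<xi> \<alpha>) X p)"
proof -
  let ?B = "bracket (\<xi> \<alpha>) X p" and ?C = "bracket (\<xi> \<alpha>) (\<lambda>q. f q (X q)) p"
  have T [simp]: "?B \<in> T p" "?C \<in> T p"
    using VF_T[of "bracket (\<xi> \<alpha>) X" p] VF_T[of "bracket (\<xi> \<alpha>) (\<lambda>q. f q (X q))" p] by simp_all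
  have z: "bracket (\<lambda>q. 0) Y p = 0" if "VF Y" for Y
    using that by (simp add: bracket_eq D_zero)
  have "f p (f p ?B) - f p ?C = 0"
    using normality[of "\<xi> \<alpha>" X p] by (simp add: nijenhuis_def z)
  then have v: "f p (f p ?B - ?C) = 0" by simp
  have "g p ?C (\<xi> \<beta> p) = 0" if [simp]: "\<beta> \<in> I" for \<beta>
  proof -
    have "g p ?C (\<xi> \<beta> p) = \<xi> \<alpha> p (\<lambda>q. g q (f q (X q)) (\<xi> \<beta> q))"
      by (simp add: xi_der del: g_f)
    also have "\<dots> = \<xi> \<alpha> p (\<lambda>q. 0)"
      by (rule der_cong[of "\<xi> \<alpha>"]) simp_all
    finally show ?thesis using der_simps(1)[of "\<xi> \<alpha>" p] by simp
  qed
  then have "(\<Sum>\<beta>\<in>I. g p (f p ?B - ?C) (\<xi> \<beta> p) *\<^sub>R \<xi> \<beta> p) = 0"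
    by (intro sum.neutral) simp
  then show ?thesis
    using f_f[of "f p ?B - ?C" p] v by simp
qed

text \<open>Since \<Phi> = d\<eta> and \<eta> is invariant under \<open>\<xi> \<alpha>\<close>, so
  is \<Phi>. That the Lie derivative commutes with d is carried out by hand: \<open>swap\<close>
  treats the two derivative terms and \<open>leibniz_bracket\<close> the bracket term.\<close>

lemma xi_fundamental_form:
  assumes [simp]: "VF X" "VF Y" "p \<in> U" "\<alpha> \<in> I"
  shows "\<xi> \<alpha> p (\<lambda>q. g q (X q) (f q (Y q))) =
    g p (bracket (\<xi> \<alpha>) X p) (f p (Y p)) + g p (X p) (f p (bracket (\<xi> \<alpha>) Y p))"
proof -
  let ?x = "\<xi> \<alpha>"
  define e where "e Z = (\<lambda>q. g q (Z q) (?x q))" for Z :: "'a vfield"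
  have [simp]: "SF (e Z)" if "VF Z" for Z
    using that by (simp add: e_def)
  have phi: "2 * g p (V p) (f p (W p)) = V p (e W) - W p (e V) - e (bracket V W) p"
    if "VF V" "VF W" "p \<in> U" for V W p
    unfolding e_def using fundamental_form_eq(2)[OF that assms(4)] .
  have xe: "?x q (e Z) = e (bracket ?x Z) q" if "VF Z" "q \<in> U" for Z q
    unfolding e_def using that by (simp add: xi_der)
  have swap: "?x p (\<lambda>q. V q (e W)) = bracket ?x V p (e W) + V p (e (bracket ?x W))"
    if [simp]: "VF V" "VF W" for V W
  proof -
    have "V p (\<lambda>q. ?x q (e W)) = V p (e (bracket ?x W))"
      by (rule der_cong[of V]) (simp_all add: xe)
    then show ?thesis by (simp add: bracket_app)
  qed
  have "?x p (\<lambda>q. 2 * g q (X q) (f q (Y q))) =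
      ?x p (\<lambda>q. X q (e Y) - Y q (e X) - e (bracket X Y) q)"
    by (rule der_cong[of ?x]) (simp_all add: phi)
  then have "2 * ?x p (\<lambda>q. g q (X q) (f q (Y q))) =
      ?x p (\<lambda>q. X q (e Y)) - ?x p (\<lambda>q. Y q (e X)) - ?x p (e (bracket X Y))"
    using der_simps(1,3,5)[of ?x p] by simp
  moreover have "e (bracket ?x (bracket X Y)) p =
      e (bracket (bracket ?x X) Y) p + e (bracket X (bracket ?x Y)) p"
    by (simp add: e_def leibniz_bracket[of ?x X Y p])
  ultimately show ?thesis
    using phi[of "bracket ?x X" Y p] phi[of X "bracket ?x Y" p]
    by (simp add: swap xe)
qed

text \<open>The metric is recovered from invariant tensors: g(X,Y) is the sum of the products
  \<eta>(X)\<eta>(Y) minus \<Phi>(X,fY).\<close>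

lemma xi_killing:
  assumes [simp]: "VF X" "VF Y" "p \<in> U" "\<alpha> \<in> I"
  shows "\<xi> \<alpha> p (\<lambda>q. g q (X q) (Y q)) =
    g p (bracket (\<xi> \<alpha>) X p) (Y p) + g p (X p) (bracket (\<xi> \<alpha>) Y p)"
proof -
  let ?x = "\<xi> \<alpha>"
  have ff: "g p (V p) (f p (f p (W p))) = (\<Sum>\<beta>\<in>I. g p (W p) (\<xi> \<beta> p) * g p (V p) (\<xi> \<beta> p)) - g p (V p) (W p)"
    if "VF V" "VF W" "p \<in> U" for V W p
    using that by (simp add: f_f g_sum_right)
  have "?x p (\<lambda>q. g q (X q) (f q (f q (Y q)))) =
    ?x p (\<lambda>q. (\<Sum>\<beta>\<in>I. g q (Y q) (\<xi> \<beta> q) * g q (X q) (\<xi> \<beta> q)) - g q (X q) (Y q))"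
    by (rule der_cong[of ?x]) (simp_all add: ff)
  also have "\<dots> = (\<Sum>\<beta>\<in>I. ?x p (\<lambda>q. g q (Y q) (\<xi> \<beta> q) * g q (X q) (\<xi> \<beta> q)))
      - ?x p (\<lambda>q. g q (X q) (Y q))"
    by (simp add: der_simps(5)[of ?x] der_sum[of ?x])
  also have "(\<Sum>\<beta>\<in>I. ?x p (\<lambda>q. g q (Y q) (\<xi> \<beta> q) * g q (X q) (\<xi> \<beta> q))) =
     (\<Sum>\<beta>\<in>I. g p (bracket ?x Y p) (\<xi> \<beta> p) * g p (X p) (\<xi> \<beta> p)
       + g p (Y p) (\<xi> \<beta> p) * g p (bracket ?x X p) (\<xi> \<beta> p))"
    by (rule sum.cong) (simp_all add: der_simps(3)[of ?x] xi_der)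
  finally have "?x p (\<lambda>q. g q (X q) (f q (f q (Y q)))) = \<dots> - ?x p (\<lambda>q. g q (X q) (Y q))" .
  moreover have "?x p (\<lambda>q. g q (X q) (f q (f q (Y q)))) =
      g p (bracket ?x X p) (f p (f p (Y p))) + g p (X p) (f p (f p (bracket ?x Y p)))"
    using xi_fundamental_form[of X "\<lambda>q. f q (Y q)" p \<alpha>] by (simp add: xi_bracket_f)
  ultimately show ?thesis
    using ff[of "bracket ?x X" Y p] ff[of X "bracket ?x Y" p] by (simp add: sum.distrib)
qed

text \<open>The bilinear form g(D_X \<xi>, Y) has zero symmetric part by the Killing equation, and
  its skew part is \<Phi> because d\<eta> = \<Phi>.\<close>

lemma D_xi:
  assumes [simp]: "VF X" "p \<in> U" "\<alpha> \<in> I"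
  shows "D X (\<xi> \<alpha>) p = - f p (X p)"
proof (rule field_eqI[of _ "\<lambda>q. - f q (X q)"])
  fix Y assume [simp]: "VF Y"
  let ?x = "\<xi> \<alpha>"
  have "g p (D X ?x p) (Y p) + g p (X p) (D Y ?x p) = 0"
    using xi_killing[of X Y p \<alpha>] D_metric[of ?x X Y p] by (simp add: bracket_eq)
  moreover have "2 * g p (X p) (f p (Y p)) = g p (Y p) (D X ?x p) - g p (X p) (D Y ?x p)"
    using fundamental_form_eq(2)[of X Y p \<alpha>]
    by (simp add: D_metric[of X] D_metric[of Y] bracket_eq)
  ultimately show "g p (D X ?x p) (Y p) = g p (- f p (X p)) (Y p)"
    by (simp add: g_sym[of "D X ?x p" p])
qed simp_all

lemma D_xib:
  assumes [simp]: "VF X" "p \<in> U"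
  shows "D X xib p = - (real s *\<^sub>R f p (X p))"
proof -
  have "D X xib p = (\<Sum>\<alpha>\<in>I. D X (\<xi> \<alpha>) p)"
    using D_sum_right[of I \<xi> X p] by (simp add: xib_def[abs_def])
  also have "\<dots> = (\<Sum>\<alpha>\<in>I. - f p (X p))"
    by (rule sum.cong) (simp_all add: D_xi)
  finally show ?thesis by (simp only: sum_constant_scaleR card_I scaleR_minus_right)
qed

end


context S_patch
begin

subsection \<open>The covariant derivative of the structure tensor\<close>

definition Df :: "'a vfield \<Rightarrow> 'a vfield \<Rightarrow> 'a vfield" where
  "Df X Y p = D X (\<lambda>q. f q (Y q)) p - f p (D X Y p)"

text \<open>The covariant derivative of the fundamental form, (D_X \<Phi>)(Y,Z).\<close>

definition om :: "'a vfield \<Rightarrow> 'a vfield \<Rightarrow> 'a vfield \<Rightarrow> 'a \<Rightarrow> real" where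
  "om X Y Z p = g p (Y p) (Df X Z p)"

lemma VF_Df [simp]: "VF X \<Longrightarrow> VF Y \<Longrightarrow> VF (Df X Y)"
  by (simp add: Df_def[abs_def])

lemma om_eq: "VF X \<Longrightarrow> VF Y \<Longrightarrow> VF Z \<Longrightarrow> p \<in> U \<Longrightarrow>
    om X Y Z p = g p (Y p) (D X (\<lambda>q. f q (Z q)) p) - g p (Y p) (f p (D X Z p))"
  by (simp add: om_def Df_def)

lemma om_skew:
  assumes [simp]: "VF X" "VF Y" "VF Z" "p \<in> U"
  shows "om X Z Y p = - om X Y Z p"
proof -
  have "X p (\<lambda>q. g q (Y q) (f q (Z q))) = X p (\<lambda>q. - g q (Z q) (f q (Y q)))"
    by (rule der_cong[of X]) (simp_all add: g_f_skew[of "Z _" _ "Y _"])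
  then have "X p (\<lambda>q. g q (Y q) (f q (Z q))) = - X p (\<lambda>q. g q (Z q) (f q (Y q)))"
    by (simp add: der_simps(4)[of X])
  then show ?thesis
    by (simp add: D_metric[of X] om_eq g_sym[of "D X Y p" p] g_sym[of "D X Z p" p])
qed

text \<open>Differentiate \<open>D_xi\<close> once more; the terms in which f acts on a covariant
  derivative cancel against the bracket term.\<close>

lemma curvature_xi:
  assumes [simp]: "VF X" "VF Y" "p \<in> U" "\<alpha> \<in> I"
  shows "curvature A D X Y (\<xi> \<alpha>) p = Df Y X p - Df X Y p"
proof -
  have *: "D V (D W (\<xi> \<alpha>)) p = - D V (\<lambda>q. f q (W q)) p" if [simp]: "VF V" "VF W" for V W
  proof -
    have "D V (D W (\<xi> \<alpha>)) p = D V (\<lambda>q. - f q (W q)) p"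
      by (rule D_cong) (simp_all add: D_xi)
    then show ?thesis by (simp add: D_minus_right)
  qed
  show ?thesis
    by (simp add: curvature_def * D_xi Df_def bracket_eq)
qed

lemma Rm_xi_om:
  assumes [simp]: "VF X" "VF Y" "VF Z" "p \<in> U" "\<alpha> \<in> I"
  shows "Rm X Y (\<xi> \<alpha>) Z p = om Y Z X p - om X Z Y p"
  by (simp add: Rm_def curvature_xi om_def g_sym[of _ p "Z p"])

lemma om_cyclic:
  assumes [simp]: "VF X" "VF Y" "VF Z" "p \<in> U"
  shows "om X Y Z p + om Y Z X p + om Z X Y p = 0"
proof -
  obtain \<alpha> where [simp]: "\<alpha> \<in> I" using dims(2) by (auto simp: I_def)
  have "Rm X Y (\<xi> \<alpha>) Z p + Rm Y Z (\<xi> \<alpha>) X p + Rm Z X (\<xi> \<alpha>) Y p = 0"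
    using Rm_bianchi[of X Y Z "\<xi> \<alpha>" p] Rm_skew34[of X Y "\<xi> \<alpha>" Z p]
      Rm_skew34[of Y Z "\<xi> \<alpha>" X p] Rm_skew34[of Z X "\<xi> \<alpha>" Y p] by simp
  then show ?thesis
    using om_skew[of X Y Z p] om_skew[of Y Z X p] om_skew[of Z X Y p]
    by (simp add: Rm_xi_om)
qed

lemma f_f_field:
  assumes [simp]: "VF Y" "VF X" "p \<in> U"
  shows "D X (\<lambda>q. f q (f q (Y q))) p = - D X Y p
    + (\<Sum>\<alpha>\<in>I. (g p (D X Y p) (\<xi> \<alpha> p) - g p (Y p) (f p (X p))) *\<^sub>R \<xi> \<alpha> p
          - g p (Y p) (\<xi> \<alpha> p) *\<^sub>R f p (X p))"
proof -
  have "D X (\<lambda>q. f q (f q (Y q))) p =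
      D X (\<lambda>q. (\<Sum>\<alpha>\<in>I. g q (Y q) (\<xi> \<alpha> q) *\<^sub>R \<xi> \<alpha> q) - Y q) p"
    by (rule D_cong) (simp_all add: f_f)
  also have "\<dots> = - D X Y p + (\<Sum>\<alpha>\<in>I. D X (\<lambda>q. g q (Y q) (\<xi> \<alpha> q) *\<^sub>R \<xi> \<alpha> q) p)"
    by (simp add: D_diff_right D_sum_right)
  also have "(\<Sum>\<alpha>\<in>I. D X (\<lambda>q. g q (Y q) (\<xi> \<alpha> q) *\<^sub>R \<xi> \<alpha> q) p) =
      (\<Sum>\<alpha>\<in>I. (g p (D X Y p) (\<xi> \<alpha> p) - g p (Y p) (f p (X p))) *\<^sub>R \<xi> \<alpha> p
          - g p (Y p) (\<xi> \<alpha> p) *\<^sub>R f p (X p))"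
    by (rule sum.cong) (simp_all add: D_scale_right D_metric[of X] D_xi)
  finally show ?thesis .
qed

text \<open>Product rule for f^2, paired with Z; the minus sign on the left is the skewness of f.
  The identity part of f^2 is parallel, so the right side is the derivative of the sum of \<eta>
  \<otimes> \<xi> alone.\<close>

lemma om_f:
  assumes [simp]: "VF X" "VF Y" "VF Z" "p \<in> U"
  shows "om X Z (\<lambda>q. f q (Y q)) p - om X (\<lambda>q. f q (Z q)) Y p =
    g p (X p) (f p (Y p)) * g p (Z p) (xib p) + g p (Y p) (xib p) * g p (X p) (f p (Z p))"
proof -
  have e: "g p (Z p) (f p (f p (D X Y p))) = - g p (Z p) (D X Y p)
      + (\<Sum>\<alpha>\<in>I. g p (D X Y p) (\<xi> \<alpha> p) * g p (Z p) (\<xi> \<alpha> p))"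
    by (simp add: f_f g_sum_right)
  have sk: "g p (Y p) (f p (X p)) = - g p (X p) (f p (Y p))" "g p (Z p) (f p (X p)) = - g p (X p) (f p (Z p))"
    by (simp_all add: g_f_skew[of "X p" p])
  show ?thesis
    by (simp add: om_eq f_f_field e g_sum_right g_xib sk algebra_simps sum.distrib
        sum_subtractf sum_distrib_left sum_negf)
qed

text \<open>Brackets become covariant derivatives by vanishing torsion, and everything except the
  derivatives of f cancels.\<close>

lemma nijenhuis_om:
  assumes [simp]: "VF X" "VF Y" "VF Z" "p \<in> U"
  shows "g p (Z p) (nijenhuis A f X Y p) =
    om (\<lambda>q. f q (X q)) Z Y p - om (\<lambda>q. f q (Y q)) Z X p
    + om X (\<lambda>q. f q (Z q)) Y p - om Y (\<lambda>q. f q (Z q)) X p"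
  by (simp add: nijenhuis_def om_eq bracket_eq)

text \<open>In the normality equation the cyclic identity moves fX and fY out of the differentiation
  slot, and \<open>om_f\<close> moves f between the other two slots. All terms differentiated along
  X or Y then cancel, and the two along Z combine to -2 times the left side plus products of
  g-values.\<close>

lemma om_f_right:
  assumes [simp]: "VF X" "VF Y" "VF Z" "p \<in> U"
  shows "om Z Y (\<lambda>q. f q (X q)) p = g p (Y p) (xib p) * g p (Z p) (f p (X p))"
proof -
  let ?f = "\<lambda>X q. f q (X q)"
  have "om (?f X) Z Y p - om (?f Y) Z X p + om X (?f Z) Y p - om Y (?f Z) X p =
      - 2 * g p (X p) (f p (Y p)) * g p (Z p) (xib p)"
    unfolding nijenhuis_om[OF assms, symmetric] by (simp add: normality)
  moreover have "om (?f X) Z Y p = - om Z Y (?f X) p - om Y (?f X) Z p"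
    using om_cyclic[of "?f X" Z Y p] by simp
  moreover have "om (?f Y) Z X p = - om Z X (?f Y) p - om X (?f Y) Z p"
    using om_cyclic[of "?f Y" Z X p] by simp
  moreover have "om X (?f Y) Z p = - om X Z (?f Y) p" "om Y (?f X) Z p = - om Y Z (?f X) p"
    "om Z (?f X) Y p = - om Z Y (?f X) p"
    by (simp_all add: om_skew[of X _ Z] om_skew[of Y _ Z] om_skew[of Z _ Y])
  moreover have sk: "g p (Y p) (f p (X p)) = - g p (X p) (f p (Y p))"
    "g p (Z p) (f p (X p)) = - g p (X p) (f p (Z p))" "g p (Z p) (f p (Y p)) = - g p (Y p) (f p (Z p))"
    by (simp_all add: g_f_skew[of "X p" p] g_f_skew[of "Y p" p "Z p"])
  ultimately show ?thesis
    using om_f[of X Y Z p] om_f[of Y X Z p] om_f[of Z Y X p]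
    by (simp add: algebra_simps)
qed

text \<open>The preceding lemma covers arguments in the image of f only. Using it at fX and writing
  f^2 X as -X plus structure fields reaches X itself; differentiating the structure fields gives the
  first summand.\<close>

lemma om_formula:
  assumes [simp]: "VF X" "VF Y" "VF Z" "p \<in> U"
  shows "om Z Y X p = g p (X p) (xib p) * g p (Y p) (f p (f p (Z p)))
    - g p (Y p) (xib p) * g p (Z p) (f p (f p (X p)))"
proof -
  have d: "D Z (\<lambda>q. f q (\<xi> \<alpha> q)) p = 0" if "\<alpha> \<in> I" for \<alpha>
    using that by (simp add: D_zero)
  have "D Z (\<lambda>q. f q (f q (f q (X q)))) p =
      D Z (\<lambda>q. - f q (X q)) p"
    by (rule D_cong) (simp_all add: f_f[of "f _ (X _)"])
  then have "D Z (\<lambda>q. f q (f q (f q (X q)))) p = - D Z (\<lambda>q. f q (X q)) p"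
    by (simp add: D_minus_right)
  moreover have "f p (D Z (\<lambda>q. f q (f q (X q))) p) = - f p (D Z X p)
      - g p (X p) (xib p) *\<^sub>R f p (f p (Z p))"
    by (simp add: f_f_field f_sum g_xib sum_subtractf scaleR_sum_left sum_negf)
  ultimately have "om Z Y (\<lambda>q. f q (f q (X q))) p =
      - om Z Y X p + g p (X p) (xib p) * g p (Y p) (f p (f p (Z p)))"
    by (simp add: om_eq)
  then show ?thesis using om_f_right[of "\<lambda>q. f q (X q)" Y Z p] by simp
qed

text \<open>The two terms of \<open>om_formula\<close> containing \<eta>(Z) cancel, as f^2 is
  self-adjoint. The result is the same for every \<alpha>, which lets \<open>Rm_split\<close> sum
  over \<alpha>.\<close>

lemma Rm_xi:
  assumes [simp]: "VF X" "VF Y" "VF Z" "p \<in> U" "\<alpha> \<in> I"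
  shows "Rm X Y (\<xi> \<alpha>) Z p = g p (X p) (xib p) * g p (Z p) (f p (f p (Y p)))
    - g p (Y p) (xib p) * g p (Z p) (f p (f p (X p)))"
proof -
  have "g p (X p) (f p (f p (Y p))) = g p (Y p) (f p (f p (X p)))"
    using g_f_skew[of "f p (X p)" p "Y p"] by simp
  then show ?thesis by (simp add: Rm_xi_om om_formula)
qed


subsection \<open>Curvature on sections orthogonal to the structure vector fields\<close>

definition LF :: "'a vfield \<Rightarrow> bool" where
  "LF X \<longleftrightarrow> VF X \<and> (\<forall>q\<in>U. \<forall>\<alpha>\<in>I. g q (X q) (\<xi> \<alpha> q) = 0)"

lemma LF_f [simp]: "VF X \<Longrightarrow> LF (\<lambda>q. f q (X q))"
  by (simp add: LF_def)

lemma LF_add [simp]: "LF X \<Longrightarrow> LF Y \<Longrightarrow> LF (\<lambda>q. X q + Y q)"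
  by (simp add: LF_def)

lemma LF_scale [simp]: "SF h \<Longrightarrow> LF X \<Longrightarrow> LF (\<lambda>q. h q *\<^sub>R X q)"
  by (simp add: LF_def)

lemma LF_VF [simp]: "LF X \<Longrightarrow> VF X"
  by (simp add: LF_def)

lemma LF_xi [simp]: "LF X \<Longrightarrow> q \<in> U \<Longrightarrow> \<alpha> \<in> I \<Longrightarrow> g q (X q) (\<xi> \<alpha> q) = 0"
  by (simp add: LF_def)

lemma LF_xib [simp]: "LF X \<Longrightarrow> q \<in> U \<Longrightarrow> g q (X q) (xib q) = 0"
  by (simp add: g_xib)

lemma LF_f_f [simp]: "LF X \<Longrightarrow> q \<in> U \<Longrightarrow> f q (f q (X q)) = - X q"
  by (simp add: f_f)

text \<open>Commute f past both covariant derivatives in R(X,Y)(fZ). The remainders along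
  \<open>xib\<close> vanish against W in L, except where \<open>xib\<close> is differentiated again
  or where D Z has left L; these two effects give the right side.\<close>

lemma Rm_f:
  assumes L [simp]: "LF X" "LF Y" "LF Z" "LF W" and [simp]: "p \<in> U"
  shows "Rm X Y (\<lambda>q. f q (Z q)) W p + Rm X Y Z (\<lambda>q. f q (W q)) p =
    real s * (g p (Z p) (f p (X p)) * g p (Y p) (W p) - g p (Z p) (f p (Y p)) * g p (X p) (W p)
      + g p (Y p) (Z p) * g p (X p) (f p (W p)) - g p (X p) (Z p) * g p (Y p) (f p (W p)))"
proof -
  have Df': "g p (W p) (Df V Z' p) = - g p (Z' p) (xib p) * g p (V p) (W p)"
    if [simp]: "LF V" "VF Z'" for V Z'
    using om_formula[of Z' W V p] by (simp add: om_def g_sym[of "W p" p])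
  have Df_eq: "Df V Z q = g q (V q) (Z q) *\<^sub>R xib q" if [simp]: "VF V" "q \<in> U" for V q
    by (rule field_eqI) (use om_formula[of Z _ V q] in \<open>simp_all add: om_def g_sym[of _ q]\<close>)
  \<comment> \<open>Differentiating \<eta>(Z) = 0 measures how far the covariant derivative of a
    section of L leaves L.\<close>
  have eb: "g p (D V Z p) (xib p) = real s * g p (Z p) (f p (V p))" if [simp]: "VF V" for V
  proof -
    have "V p (\<lambda>q. g q (Z q) (xib q)) = V p (\<lambda>q. 0)"
      by (rule der_cong[of V]) simp_all
    then show ?thesis
      using der_simps(1)[of V p] by (simp add: D_metric[of V] D_xib)
  qed
  have DD: "g p (D V (D V' (\<lambda>q. f q (Z q))) p) (W p) = g p (f p (D V (D V' Z) p)) (W p)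
      - real s * g p (Z p) (f p (V' p)) * g p (V p) (W p)
      + real s * g p (V' p) (Z p) * g p (V p) (f p (W p))"
    if [simp]: "LF V" "LF V'" for V V'
  proof -
    have "D V' (\<lambda>q. f q (Z q)) q = f q (D V' Z q) + g q (V' q) (Z q) *\<^sub>R xib q" if [simp]: "q \<in> U" for q
      using Df_eq[of V' q] by (simp add: Df_def algebra_simps)
    then have "D V (D V' (\<lambda>q. f q (Z q))) p =
        D V (\<lambda>q. f q (D V' Z q) + g q (V' q) (Z q) *\<^sub>R xib q) p"
      by (intro D_cong) simp_all
    also have "\<dots> = f p (D V (D V' Z) p) + Df V (D V' Z) p + (V p (\<lambda>q. g q (V' q) (Z q)) *\<^sub>R xib p
         - (g p (V' p) (Z p) * real s) *\<^sub>R f p (V p))"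
      by (simp add: D_add_right D_scale_right D_xib Df_def)
    finally have E: "D V (D V' (\<lambda>q. f q (Z q))) p = \<dots>" .
    show ?thesis
      using arg_cong[OF E, of "\<lambda>v. g p v (W p)"]
      by (simp add: g_sym[of "Df V (D V' Z) p" p] Df' eb g_sym[of "xib p" p] algebra_simps)
  qed
  have "D (bracket X Y) (\<lambda>q. f q (Z q)) p = f p (D (bracket X Y) Z p) + g p (bracket X Y p) (Z p) *\<^sub>R xib p"
    using Df_eq[of "bracket X Y" p] by (simp add: Df_def algebra_simps)
  then show ?thesis
    by (simp add: Rm_eq DD g_sym[of "xib p" p] algebra_simps)
qed

end


text \<open>
  On the quadrilinear form \<open>E a b c d = R a (J b) (J c) d\<close>, the part of
  \<open>E (x + y) (x + y) (x + y) (x + y)\<close> that is quadratic in both variables reduces, by the symmetries,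
  to \<open>2 * (B x y + 3 * B x (J y))\<close> with \<open>B x y = R x y y x\<close>; replacing \<open>y\<close> by \<open>J y\<close> exchanges the
  two summands.  Neither negation nor linearity of \<open>J\<close> is available on \<open>S\<close> as an equality of
  elements, so \<open>J (J y)\<close> plays the role of \<open>- y\<close>.
\<close>

lemma kaehler_like_vanishing:
  fixes R :: "'v::plus \<Rightarrow> 'v \<Rightarrow> 'v \<Rightarrow> 'v \<Rightarrow> real"
  assumes add_S [simp]: "\<And>x y. x \<in> S \<Longrightarrow> y \<in> S \<Longrightarrow> x + y \<in> S"
    and J_S [simp]: "\<And>x. x \<in> S \<Longrightarrow> J x \<in> S"
    and add1: "\<And>x x' y z w. \<lbrakk>x \<in> S; x' \<in> S; y \<in> S; z \<in> S; w \<in> S\<rbrakk> \<Longrightarrow>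
        R (x + x') y z w = R x y z w + R x' y z w"
    and J_add1: "\<And>x x' y z w. \<lbrakk>x \<in> S; x' \<in> S; y \<in> S; z \<in> S; w \<in> S\<rbrakk> \<Longrightarrow>
        R (J (x + x')) y z w = R (J x) y z w + R (J x') y z w"
    and JJ1: "\<And>x y z w. \<lbrakk>x \<in> S; y \<in> S; z \<in> S; w \<in> S\<rbrakk> \<Longrightarrow> R (J (J x)) y z w = - R x y z w"
    and skew12: "\<And>x y z w. \<lbrakk>x \<in> S; y \<in> S; z \<in> S; w \<in> S\<rbrakk> \<Longrightarrow> R y x z w = - R x y z w"
    and pair: "\<And>x y z w. \<lbrakk>x \<in> S; y \<in> S; z \<in> S; w \<in> S\<rbrakk> \<Longrightarrow> R x y z w = R z w x y"
    and bianchi: "\<And>x y z w. \<lbrakk>x \<in> S; y \<in> S; z \<in> S; w \<in> S\<rbrakk> \<Longrightarrow>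
        R x y z w + R y z x w + R z x y w = 0"
    and J_inv: "\<And>x y z w. \<lbrakk>x \<in> S; y \<in> S; z \<in> S; w \<in> S\<rbrakk> \<Longrightarrow> R x y (J z) w + R x y z (J w) = 0"
    and hol: "\<And>x. x \<in> S \<Longrightarrow> R x (J x) (J x) x = 0"
    and xy [simp]: "x \<in> S" "y \<in> S"
  shows "R x y y x = 0"
proof -
  have skew34: "R x y w z = - R x y z w" if [simp]: "x \<in> S" "y \<in> S" "z \<in> S" "w \<in> S" for x y z w
    using pair[of x y w z] skew12[of z w x y] pair[of z w x y] by simp
  have J_add2: "R y (J (x + x')) z w = R y (J x) z w + R y (J x') z w"
    if [simp]: "x \<in> S" "x' \<in> S" "y \<in> S" "z \<in> S" "w \<in> S" for x x' y z w
    using J_add1[of x x' y z w] skew12[of y "J (x + x')" z w] skew12[of y "J x" z w]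
      skew12[of y "J x'" z w] by simp
  have J_add3: "R z w (J (x + x')) y = R z w (J x) y + R z w (J x') y"
    if [simp]: "x \<in> S" "x' \<in> S" "y \<in> S" "z \<in> S" "w \<in> S" for x x' y z w
    using J_add1[of x x' y z w] pair[of z w "J (x + x')" y] pair[of z w "J x" y]
      pair[of z w "J x'" y] by simp
  have add4: "R z w y (x + x') = R z w y x + R z w y x'"
    if [simp]: "x \<in> S" "x' \<in> S" "y \<in> S" "z \<in> S" "w \<in> S" for x x' y z w
    using add1[of x x' y z w] pair[of "x + x'" y z w] pair[of x y z w] pair[of x' y z w]
      skew34[of z w y "x + x'"] skew34[of z w y x] skew34[of z w y x'] by simp
  have JJ2: "R y (J (J x)) z w = - R y x z w"
    if [simp]: "x \<in> S" "y \<in> S" "z \<in> S" "w \<in> S" for x y z w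
    using JJ1[of x y z w] skew12[of y "J (J x)" z w] skew12[of y x z w] by simp
  have JJ3: "R z w (J (J x)) y = - R z w x y"
    if [simp]: "x \<in> S" "y \<in> S" "z \<in> S" "w \<in> S" for x y z w
    using JJ1[of x y z w] pair[of z w "J (J x)" y] pair[of z w x y] by simp
  have JJ4: "R z w y (J (J x)) = - R z w y x"
    if [simp]: "x \<in> S" "y \<in> S" "z \<in> S" "w \<in> S" for x y z w
    using JJ3[of x y z w] skew34[of z w y "J (J x)"] skew34[of z w y x] by simp
  \<comment> \<open>The terms of degree 4 in one variable are removed by \<open>hol\<close> at
    \<open>x\<close> and at \<open>z\<close>; the fourteen mixed ones remain.\<close>
  have expand: "R x (J x) (J x) z + R x (J x) (J z) x + R x (J z) (J x) x + R z (J x) (J x) x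
      + (R x (J x) (J z) z + R x (J z) (J x) z + R x (J z) (J z) x
        + R z (J x) (J x) z + R z (J x) (J z) x + R z (J z) (J x) x)
      + R x (J z) (J z) z + R z (J x) (J z) z + R z (J z) (J x) z + R z (J z) (J z) x = 0"
    if [simp]: "x \<in> S" "z \<in> S" for x z
    using hol[of "x + z"] hol[of x] hol[of z] by (simp add: add1 J_add2 J_add3 add4)
  \<comment> \<open>Passing from \<open>y\<close> to \<open>J (J y)\<close> reverses the terms of
    odd degree in \<open>y\<close>; adding both expansions leaves the biquadratic part.\<close>
  have six: "R x (J x) (J y) y + R x (J y) (J x) y + R x (J y) (J y) x
        + R y (J x) (J x) y + R y (J x) (J y) x + R y (J y) (J x) x = 0"
    if [simp]: "x \<in> S" "y \<in> S" for x y
    using expand[of x y] expand[of x "J (J y)"] by (simp add: JJ1 JJ2 JJ3 JJ4)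
  have B: "R x y y x + 3 * R x (J y) (J y) x = 0" if [simp]: "x \<in> S" "y \<in> S" for x y
  proof -
    have T1: "R y (J y) (J x) x = R x (J x) (J y) y"
      using pair[of y "J y" "J x" x] skew12[of "J x" x y "J y"] skew34[of x "J x" y "J y"] by simp
    have T3: "R y (J x) (J y) x = R x (J y) (J x) y"
      using pair[of y "J x" "J y" x] skew12[of x "J y" y "J x"] skew34[of x "J y" "J x" y] by simp
    have T5: "R y (J x) (J x) y = R x (J y) (J y) x"
      using J_inv[of y "J x" x y] pair[of y "J x" x "J y"] J_inv[of x "J y" y x] by simp
    have T4: "R x (J y) (J x) y = R x (J y) (J y) x"
      using J_inv[of x "J y" x y] skew34[of x "J y" x "J y"] by simp
    \<comment> \<open>The one term that is not yet of the form \<open>B\<close> is reduced by the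
      Bianchi identity for \<open>x\<close>, \<open>J x\<close>, \<open>J y\<close>.\<close>
    have "R (J x) (J y) x y = - R x y y x"
      using pair[of "J x" "J y" x y] J_inv[of x y x "J y"] JJ4[of y x x y] skew34[of x y x y] by simp
    moreover have "R (J y) x (J x) y = - R x (J y) (J x) y"
      by (rule skew12) simp_all
    ultimately have "R x (J x) (J y) y = R x y y x + R x (J y) (J y) x"
      using bianchi[of x "J x" "J y" y] T4 by simp
    then show ?thesis using six[of x y] T1 T3 T4 T5 by simp
  qed
  have "R x (J (J y)) (J (J y)) x = R x y y x"
    by (simp add: JJ2 JJ3)
  \<comment> \<open>The equations u + 3v = 0 and v + 3u = 0 have determinant -8, so both unknowns
    vanish.\<close>
  then show ?thesis using B[of x y] B[of x "J y"] by simp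
qed

section \<open>Pointwise multilinearity of the curvature\<close>

context riemannian_patch
begin

lemma Rm_slots:
  assumes [simp]: "VF X" "VF X1" "VF X2" "VF Y" "VF Z" "VF W" "p \<in> U"
    and X: "X p = a *\<^sub>R X1 p + b *\<^sub>R X2 p"
  shows "Rm X Y Z W p = a * Rm X1 Y Z W p + b * Rm X2 Y Z W p"
    and "Rm Y X Z W p = a * Rm Y X1 Z W p + b * Rm Y X2 Z W p"
    and "Rm Y Z X W p = a * Rm Y Z X1 W p + b * Rm Y Z X2 W p"
    and "Rm Y Z W X p = a * Rm Y Z W X1 p + b * Rm Y Z W X2 p"
proof -
  have 4: "Rm Y Z W X p = a * Rm Y Z W X1 p + b * Rm Y Z W X2 p"
    if [simp]: "VF Y" "VF Z" "VF W" for Y Z W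
    by (simp add: Rm_def X)
  have 3: "Rm Y Z X W p = a * Rm Y Z X1 W p + b * Rm Y Z X2 W p"
    if [simp]: "VF Y" "VF Z" "VF W" for Y Z W
    using 4[of Y Z W] by (simp add: Rm_skew34[of Y Z W])
  show "Rm Y Z W X p = a * Rm Y Z W X1 p + b * Rm Y Z W X2 p"
    "Rm Y Z X W p = a * Rm Y Z X1 W p + b * Rm Y Z X2 W p"
    using 3 4 by simp_all
  show 1: "Rm X Y Z W p = a * Rm X1 Y Z W p + b * Rm X2 Y Z W p"
    using 3[of Z W Y] by (simp add: Rm_pair[of _ Y])
  then show "Rm Y X Z W p = a * Rm Y X1 Z W p + b * Rm Y X2 Z W p"
    by (simp add: Rm_skew12[of _ Y])
qed

lemma Rm_scale:
  assumes [simp]: "VF X" "VF V" "VF Y" "VF Z" "VF W" "p \<in> U" and X: "X p = a *\<^sub>R V p"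
  shows "Rm X Y Z W p = a * Rm V Y Z W p"
    and "Rm Y X Z W p = a * Rm Y V Z W p"
    and "Rm Y Z X W p = a * Rm Y Z V W p"
    and "Rm Y Z W X p = a * Rm Y Z W V p"
  using Rm_slots[of X V V Y Z W p a 0] X by simp_all

end


section \<open>Constant f-sectional curvature and its model tensor\<close>

context S_patch
begin

lemma f_f_f [simp]: "x \<in> T p \<Longrightarrow> f p (f p (f p x)) = - f p x"
  by (simp add: f_f[of "f p x"])

lemma L_section_iff_LF: "L_section A s \<xi> g U X \<longleftrightarrow> LF X"
proof -
  have "(\<forall>v\<in>span ((\<lambda>\<alpha>. \<xi> \<alpha> p) ` {1..s}). g p (X p) v = 0) \<longleftrightarrow> (\<forall>\<alpha>\<in>I. g p (X p) (\<xi> \<alpha> p) = 0)"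
    (is "?L \<longleftrightarrow> ?R") if [simp]: "VF X" "p \<in> U" for p
  proof
    assume ?L
    then show ?R by (auto simp: I_def intro: span_base)
  next
    assume R: ?R
    have "span ((\<lambda>\<alpha>. \<xi> \<alpha> p) ` {1..s}) \<subseteq> {v \<in> T p. g p (X p) v = 0}"
    proof (rule span_minimal)
      show "subspace {v \<in> T p. g p (X p) v = 0}"
        by (rule subspaceI) simp_all
      show "(\<lambda>\<alpha>. \<xi> \<alpha> p) ` {1..s} \<subseteq> {v \<in> T p. g p (X p) v = 0}"
        using R unfolding I_def[symmetric] by auto
    qed
    then show ?L by blast
  qed
  then show ?thesis
    unfolding L_section_def LF_def L_distribution_def by auto
qed

text \<open>The hypothesis speaks of unit fields, polarisation needs arbitrary ones. Where X is
  nonzero it is normalised on a neighbourhood, and the factor u^4 is undone by |X|^4; where X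
  vanishes both sides are 0.\<close>

lemma f_sectional_quartic:
  assumes c: "constant_f_sectional_curvature A s f \<xi> g D c" and LX [simp]: "LF X" and [simp]: "p \<in> U"
  shows "Rm X (\<lambda>q. f q (X q)) (\<lambda>q. f q (X q)) X p = c * (g p (X p) (X p))\<^sup>2"
proof (cases "X p = 0")
  case True
  then show ?thesis by (simp add: Rm_def)
next
  case False
  let ?h = "\<lambda>q. g q (X q) (X q)"
  define V where "V = ?h -` {0<..} \<inter> U"
  have "continuous_on U ?h"
    by (rule smooth_fun_continuous) simp_all
  then have V: "open V"
    unfolding V_def using continuous_on_open_vimage[OF open_U] open_greaterThan by blast
  have VU: "V \<subseteq> U" by (auto simp: V_def)
  have pV [simp]: "p \<in> V" using False g_pos[of "X p" p] by (simp add: V_def)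
  interpret V: S_patch A g D V n s f \<xi> \<eta>
    by unfold_locales (rule metric levi_civita V S_manifold)+
  have X [simp]: "V.LF X"
    using LX VU unfolding V.LF_def LF_def vector_field_on_def by auto
  define u where "u = (\<lambda>q. inverse (sqrt (?h q)))"
  have "V.SF ?h" by simp
  then have u [simp]: "V.SF u"
    unfolding u_def by (rule smooth_fun_inverse_sqrt[OF V]) (simp add: V_def)
  define Z where "Z = (\<lambda>q. u q *\<^sub>R X q)"
  have Z [simp]: "V.LF Z" unfolding Z_def by simp
  have u2: "u q * u q * ?h q = 1" if "q \<in> V" for q
  proof -
    have "?h q > 0" using that by (simp add: V_def)
    then show ?thesis by (simp add: u_def field_simps)
  qed
  have "g q (Z q) (Z q) = 1" if "q \<in> V" for q
    using u2[OF that] that by (simp add: Z_def mult_ac)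
  then have "sectional_curvature A g D Z (\<lambda>q. f q (Z q)) p = c"
    using c[unfolded constant_f_sectional_curvature_def, rule_format, of V Z p]
      V.L_section_iff_LF[of Z] V by simp
  then have "c = Rm Z (\<lambda>q. f q (Z q)) (\<lambda>q. f q (Z q)) Z p"
    by (simp add: sectional_curvature_def Rm_def)
  also have "\<dots> = u p * (u p * (u p * (u p * Rm X (\<lambda>q. f q (X q)) (\<lambda>q. f q (X q)) X p)))"
    using V.Rm_scale[of Z X _ _ _ p "u p"] V.Rm_scale[of "\<lambda>q. f q (Z q)" "\<lambda>q. f q (X q)" _ _ _ p "u p"]
    by (simp add: Z_def)
  finally have "c * (?h p)\<^sup>2 =
      (u p * u p * ?h p) * (u p * u p * ?h p) * Rm X (\<lambda>q. f q (X q)) (\<lambda>q. f q (X q)) X p"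
    by (simp add: power2_eq_square)
  then show ?thesis using u2[of p] by simp
qed

text \<open>The \<open>a\<close> part is the tensor of constant curvature; for \<open>a = b\<close>
  the whole is, on L, the tensor of a complex space form. The weights are kept apart because
  \<open>a - b\<close> measures the failure to commute with f.\<close>

definition model :: "real \<Rightarrow> real \<Rightarrow> 'a vfield \<Rightarrow> 'a vfield \<Rightarrow> 'a vfield \<Rightarrow> 'a vfield \<Rightarrow> 'a \<Rightarrow> real" where
  "model a b X Y Z W p =
     a * (g p (X p) (W p) * g p (Y p) (Z p) - g p (X p) (Z p) * g p (Y p) (W p))
     + b * (g p (X p) (f p (W p)) * g p (Y p) (f p (Z p))
         - g p (X p) (f p (Z p)) * g p (Y p) (f p (W p))
         - 2 * g p (X p) (f p (Y p)) * g p (Z p) (f p (W p)))"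

lemma Rm_LF:
  assumes c: "constant_f_sectional_curvature A s f \<xi> g D c"
    and [simp]: "LF X" "LF Y" "p \<in> U"
  shows "Rm X Y Y X p = (c + 3 * real s) / 4 * (g p (X p) (X p) * g p (Y p) (Y p) - (g p (X p) (Y p))\<^sup>2)
    + 3 * (c - real s) / 4 * (g p (X p) (f p (Y p)))\<^sup>2"
proof -
  \<comment> \<open>The unique solution of a - b = s, which matches the defect in
    \<open>Rm_f\<close>, and a + 3b = c, the value of the model on the plane of X and fX.\<close>
  define a b where "a = (c + 3 * real s) / 4" and "b = (c - real s) / 4"
  have sc: "real s = a - b" "c = a + 3 * b" by (simp_all add: a_def b_def field_simps)
  let ?R = "\<lambda>X Y Z W. Rm X Y Z W p - model a b X Y Z W p"
  have sym: "g p (Y p) (X p) = g p (X p) (Y p)" and skew: "g p (Y p) (f p (X p)) = - g p (X p) (f p (Y p))"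
    if "LF X" "LF Y" for X Y
    using that by (simp_all add: g_sym[of "Y p"] g_f_skew[of "X p" p "Y p"])
  have self: "g p (X p) (f p (X p)) = 0" if "LF X" for X
    using skew[OF that that] by simp
  have "?R X Y Y X = 0"
  proof (rule kaehler_like_vanishing[where R = ?R and x = X and y = Y and S = "{X. LF X}" and J = "\<lambda>X q. f q (X q)"])
    fix X Y Z W assume "X \<in> {X. LF X}" "Y \<in> {X. LF X}" "Z \<in> {X. LF X}" "W \<in> {X. LF X}"
    then have L [simp]: "LF X" "LF Y" "LF Z" "LF W" by simp_all
    note sy = sym[of X Y] sym[of X Z] sym[of X W] sym[of Y Z] sym[of Y W] sym[of Z W]
      skew[of X Y] skew[of X Z] skew[of X W] skew[of Y Z] skew[of Y W] skew[of Z W]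
    show "?R (\<lambda>q. f q (f q (X q))) Y Z W = - ?R X Y Z W"
      using Rm_scale(1)[of "\<lambda>q. f q (f q (X q))" X Y Z W p "-1"]
      by (simp add: model_def algebra_simps)
    show "?R Y X Z W = - ?R X Y Z W"
      by (simp add: Rm_skew12[of X Y] model_def sy algebra_simps)
    show "?R X Y Z W = ?R Z W X Y"
      by (simp add: Rm_pair[of X Y] model_def sy algebra_simps)
    show "?R X Y Z W + ?R Y Z X W + ?R Z X Y W = 0"
      using Rm_bianchi[of X Y Z W p] by (simp add: model_def sy algebra_simps)
    show "?R X Y (\<lambda>q. f q (Z q)) W + ?R X Y Z (\<lambda>q. f q (W q)) = 0"
      using Rm_f[of X Y Z W p] by (simp add: model_def sy sc(1) algebra_simps)
  next
    fix X assume "X \<in> {X. LF X}"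
    then have [simp]: "LF X" by simp
    show "?R X (\<lambda>q. f q (X q)) (\<lambda>q. f q (X q)) X = 0"
      by (simp add: f_sectional_quartic[OF c] model_def self sc(2) power2_eq_square algebra_simps)
  next
    fix X X' Y Z W
    assume "X \<in> {X. LF X}" "X' \<in> {X. LF X}" "Y \<in> {X. LF X}" "Z \<in> {X. LF X}" "W \<in> {X. LF X}"
    then have L [simp]: "LF X" "LF X'" "LF Y" "LF Z" "LF W" by simp_all
    define V where "V = X + X'"
    have [simp]: "V q = X q + X' q" for q by (simp add: V_def)
    have [simp]: "VF V" using VF_add[of X X'] by (simp add: V_def plus_fun_def)
    show "?R (X + X') Y Z W = ?R X Y Z W + ?R X' Y Z W"
      unfolding V_def[symmetric]
      using Rm_slots(1)[of V X X' Y Z W p 1 1]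
      by (simp add: model_def algebra_simps)
    show "?R (\<lambda>q. f q ((X + X') q)) Y Z W = ?R (\<lambda>q. f q (X q)) Y Z W + ?R (\<lambda>q. f q (X' q)) Y Z W"
      unfolding V_def[symmetric]
      using Rm_slots(1)[of "\<lambda>q. f q (V q)" "\<lambda>q. f q (X q)" "\<lambda>q. f q (X' q)" Y Z W p 1 1]
      by (simp add: model_def algebra_simps)
  next
    fix X X' assume "X \<in> {X. LF X}" "X' \<in> {X. LF X}"
    then show "X + X' \<in> {X. LF X}" using LF_add[of X X'] by (simp add: plus_fun_def)
  qed simp_all
  then have "Rm X Y Y X p = a * (g p (X p) (X p) * g p (Y p) (Y p) - (g p (X p) (Y p))\<^sup>2)
      + 3 * b * (g p (X p) (f p (Y p)))\<^sup>2"
    by (simp add: model_def sym[of X Y] skew[of X Y] self power2_eq_square algebra_simps)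
  then show ?thesis by (simp add: a_def b_def)
qed


subsection \<open>Curvature of arbitrary planes\<close>

text \<open>W is -f^2 W plus structure fields. By \<open>Rm_xi\<close> each structure field
  contributes the same factor, so the sum of their coefficients is g(W,xib).\<close>

lemma Rm_split:
  assumes [simp]: "VF X" "VF Y" "VF Z" "VF W" "p \<in> U"
  shows "Rm X Y Z W p = - Rm X Y Z (\<lambda>q. f q (f q (W q))) p
    - g p (W p) (xib p) * (g p (X p) (xib p) * g p (Z p) (f p (f p (Y p)))
        - g p (Y p) (xib p) * g p (Z p) (f p (f p (X p))))"
proof -
  let ?c = "curvature A D X Y Z p"
  have T [simp]: "?c \<in> T p" using VF_T[of "curvature A D X Y Z" p] by simp
  have "W p = - f p (f p (W p)) + (\<Sum>\<alpha>\<in>I. g p (W p) (\<xi> \<alpha> p) *\<^sub>R \<xi> \<alpha> p)"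
    by (simp add: f_f)
  then have "g p ?c (W p) = g p ?c (- f p (f p (W p)) + (\<Sum>\<alpha>\<in>I. g p (W p) (\<xi> \<alpha> p) *\<^sub>R \<xi> \<alpha> p))"
    by (rule arg_cong)
  also have "\<dots> = - g p ?c (f p (f p (W p))) + (\<Sum>\<alpha>\<in>I. g p (W p) (\<xi> \<alpha> p) * g p ?c (\<xi> \<alpha> p))"
    by (simp add: g_sum_right)
  also have "(\<Sum>\<alpha>\<in>I. g p (W p) (\<xi> \<alpha> p) * g p ?c (\<xi> \<alpha> p)) =
      (\<Sum>\<alpha>\<in>I. g p (W p) (\<xi> \<alpha> p) * - (g p (X p) (xib p) * g p (Z p) (f p (f p (Y p)))
        - g p (Y p) (xib p) * g p (Z p) (f p (f p (X p)))))"
  proof (rule sum.cong[OF refl])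
    fix \<alpha> assume [simp]: "\<alpha> \<in> I"
    have "g p ?c (\<xi> \<alpha> p) = - Rm X Y (\<xi> \<alpha>) Z p"
      by (simp add: Rm_skew34[of X Y Z] flip: Rm_def)
    then show "g p (W p) (\<xi> \<alpha> p) * g p ?c (\<xi> \<alpha> p) =
        g p (W p) (\<xi> \<alpha> p) * - (g p (X p) (xib p) * g p (Z p) (f p (f p (Y p)))
        - g p (Y p) (xib p) * g p (Z p) (f p (f p (X p))))"
      by (simp only: Rm_xi[OF assms(1-3,5) \<open>\<alpha> \<in> I\<close>])
  qed
  also have "\<dots> = g p (W p) (xib p) * - (g p (X p) (xib p) * g p (Z p) (f p (f p (Y p)))
        - g p (Y p) (xib p) * g p (Z p) (f p (f p (X p))))"
    by (simp only: sum_distrib_right[symmetric] g_xib[OF VF_T[OF assms(4,5)]])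
  finally show ?thesis by (simp add: Rm_def algebra_simps)
qed

text \<open>Here \<open>m\<close> is g applied to the L-components. \<open>Rm_split\<close> and the
  symmetries replace the slots one after another by f(f _), the negative of the L-component, until
  \<open>Rm_LF\<close> applies; the corrections picked up on the way form the terms with
  \<open>xib\<close>.\<close>

lemma Rm_general:
  assumes c: "constant_f_sectional_curvature A s f \<xi> g D c"
    and [simp]: "VF X" "VF Y" "p \<in> U"
  defines "m \<equiv> \<lambda>V W. - g p (V p) (f p (f p (W p)))"
  shows "Rm X Y Y X p = (c + 3 * real s) / 4 * (m X X * m Y Y - (m X Y)\<^sup>2)
    + 3 * (c - real s) / 4 * (g p (X p) (f p (Y p)))\<^sup>2
    + (g p (Y p) (xib p))\<^sup>2 * m X X + (g p (X p) (xib p))\<^sup>2 * m Y Y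
    - 2 * g p (X p) (xib p) * g p (Y p) (xib p) * m X Y"
proof -
  let ?X = "\<lambda>q. f q (f q (X q))" and ?Y = "\<lambda>q. f q (f q (Y q))"
  have m: "m Y X = m X Y"
    using g_f_skew[of "f p (X p)" p "Y p"] by (simp add: m_def)
  have 1: "Rm X Y Y X p = Rm X Y ?X Y p - g p (X p) (xib p) *
      (g p (Y p) (xib p) * m X Y - g p (X p) (xib p) * m Y Y)"
    using Rm_split[of X Y Y X p] Rm_skew34[of X Y ?X Y p] m by (simp add: m_def)
  have 2: "Rm X Y ?X Y p = - Rm ?X ?Y ?Y X p - g p (Y p) (xib p) *
      (g p (X p) (xib p) * m X Y - g p (Y p) (xib p) * m X X)"
    using Rm_split[of X Y ?X Y p] Rm_pair[of X Y ?X ?Y p] Rm_skew34[of ?X ?Y X ?Y p]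
      Rm_split[of ?X ?Y X Y p]
    by (simp add: m_def)
  have 3: "Rm ?X ?Y ?Y X p = - Rm ?X ?Y ?Y ?X p"
    using Rm_split[of ?X ?Y ?Y X p] by simp
  have 4: "Rm ?X ?Y ?Y ?X p = (c + 3 * real s) / 4 * (m X X * m Y Y - (m X Y)\<^sup>2)
      + 3 * (c - real s) / 4 * (g p (X p) (f p (Y p)))\<^sup>2"
    using Rm_LF[OF c, of ?X ?Y p] by (simp add: m_def)
  show ?thesis
    unfolding 1 2 3 4 by (simp add: algebra_simps power2_eq_square)
qed

end


context riemannian_patch
begin

subsection \<open>Orthonormal frames\<close>

text \<open>A nonzero remainder would be orthogonal to the family and enlarge it to DIM('b) + 1
  independent tangent vectors.\<close>

lemma orthonormal_expansion:
  assumes e: "\<And>i. i \<in> {1..DIM('b)} \<Longrightarrow> e i \<in> T p"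
    and on: "\<And>i j. i \<in> {1..DIM('b)} \<Longrightarrow> j \<in> {1..DIM('b)} \<Longrightarrow> g p (e i) (e j) = (if i = j then 1 else 0)"
    and x: "x \<in> T p"
  shows "x = (\<Sum>i=1..DIM('b). g p x (e i) *\<^sub>R e i)"
proof (rule ccontr)
  let ?N = "{1..DIM('b)}"
  define r where "r = x - (\<Sum>i\<in>?N. g p x (e i) *\<^sub>R e i)"
  assume "x \<noteq> (\<Sum>i\<in>?N. g p x (e i) *\<^sub>R e i)"
  then have r0: "r \<noteq> 0" by (simp add: r_def)
  have r [simp]: "r \<in> T p" unfolding r_def using x e by (intro T_closed T_sum) auto
  have re: "g p r (e j) = 0" if j: "j \<in> ?N" for j
  proof -
    have "g p r (e j) = g p x (e j) - (\<Sum>i\<in>?N. g p (g p x (e i) *\<^sub>R e i) (e j))"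
    proof -
      have eT: "g p x (e i) *\<^sub>R e i \<in> T p" if "i \<in> ?N" for i
        using e[OF that] by simp
      show ?thesis
        using g_left(5)[OF x T_sum[of ?N "\<lambda>i. g p x (e i) *\<^sub>R e i", OF eT] e[OF j]]
          g_sum_left[of ?N "\<lambda>i. g p x (e i) *\<^sub>R e i", OF eT e[OF j]]
        by (simp only: r_def)
    qed
    also have "(\<Sum>i\<in>?N. g p (g p x (e i) *\<^sub>R e i) (e j)) = (\<Sum>i\<in>?N. if i = j then g p x (e j) else 0)"
      by (rule sum.cong[OF refl]) (use e on j in auto)
    finally show ?thesis using j by simp
  qed
  have inj: "inj_on e ?N"
  proof (rule inj_onI)
    fix i j assume i: "i \<in> ?N" and j: "j \<in> ?N" and "e i = e j"
    then show "i = j" using on[OF i j] on[OF i i] by (simp split: if_splits)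
  qed
  have nr: "r \<notin> e ` ?N"
  proof
    assume "r \<in> e ` ?N"
    then obtain i where "i \<in> ?N" "r = e i" by blast
    then have "g p r r = 0" using re[of i] by (simp only:)
    then show False using r0 by simp
  qed
  let ?B = "insert r (e ` ?N)"
  have BT: "?B \<subseteq> T p" using e by auto
  have orth: "g p v w = 0" if "v \<in> ?B" "w \<in> ?B" "v \<noteq> w" for v w
    using that re on e g_sym[of r p] by auto
  have scalar: "h v = 0" if s: "(\<Sum>w\<in>?B. h w *\<^sub>R w) = 0" and v: "v \<in> ?B" for h v
  proof -
    have vT: "v \<in> T p" using v BT by blast
    have "0 = g p (\<Sum>w\<in>?B. h w *\<^sub>R w) v" using s vT by simp
    also have "\<dots> = (\<Sum>w\<in>?B. g p (h w *\<^sub>R w) v)"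
      by (rule g_sum_left) (use BT vT in auto)
    also have "\<dots> = (\<Sum>w\<in>?B. if w = v then h v * g p v v else 0)"
    proof (rule sum.cong[OF refl])
      fix w assume w: "w \<in> ?B"
      then have "w \<in> T p" using BT by blast
      then show "g p (h w *\<^sub>R w) v = (if w = v then h v * g p v v else 0)"
        using orth[OF w v] vT by auto
    qed
    also have "\<dots> = h v * g p v v" using v by (subst sum.delta) auto
    finally have hv: "h v * g p v v = 0" by (rule sym)
    have "v \<noteq> 0"
    proof -
      have "e i \<noteq> 0" if i: "i \<in> ?N" for i
        using on[OF i i] e[OF i] by auto
      then show ?thesis using v r0 by auto
    qed
    then have "g p v v \<noteq> 0" unfolding g_eq_0[OF vT] .
    then show ?thesis using hv by simp
  qed
  text \<open>Explicit instantiation: the vectors are functions, so unifying \<open>?h ?v\<close> would diverge.\<close>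
  have "independent ?B"
    apply (rule independent_if_scalars_zero)
    subgoal by simp
    subgoal for h v by (rule scalar[of h v])
    done
  from dim_tangent_space[OF this BT] have "card ?B \<le> DIM('b)" by simp
  moreover have "card ?B = Suc DIM('b)"
    using nr card_image[OF inj] by simp
  ultimately show False by simp
qed

lemma parseval:
  assumes e: "\<And>i. i \<in> {1..DIM('b)} \<Longrightarrow> e i \<in> T p"
    and on: "\<And>i j. i \<in> {1..DIM('b)} \<Longrightarrow> j \<in> {1..DIM('b)} \<Longrightarrow> g p (e i) (e j) = (if i = j then 1 else 0)"
    and x: "x \<in> T p" and y: "y \<in> T p"
  shows "(\<Sum>i=1..DIM('b). g p x (e i) * g p (e i) y) = g p x y"
proof -
  have "g p x y = g p (\<Sum>i=1..DIM('b). g p x (e i) *\<^sub>R e i) y"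
    using orthonormal_expansion[OF e on x] by simp
  also have "\<dots> = (\<Sum>i=1..DIM('b). g p (g p x (e i) *\<^sub>R e i) y)"
    by (rule g_sum_left) (use e y in auto)
  also have "\<dots> = (\<Sum>i=1..DIM('b). g p x (e i) * g p (e i) y)"
    by (rule sum.cong[OF refl]) (use e y in auto)
  finally show ?thesis by simp
qed

end


context S_patch
begin

subsection \<open>The semi-symmetric metric connection\<close>

abbreviation Dstar where "Dstar \<equiv> semi_symmetric_metric_connection s \<xi> \<eta> g D"

lemma Dstar_eq:
  assumes [simp]: "VF X" "VF Y" "p \<in> U"
  shows "Dstar X Y p = D X Y p + g p (Y p) (xib p) *\<^sub>R X p - g p (X p) (Y p) *\<^sub>R xib p"
proof -
  have "(\<Sum>j\<in>I. \<eta> j p (Y p) *\<^sub>R X p) = g p (Y p) (xib p) *\<^sub>R X p"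
    by (simp add: eta_eq g_xib scaleR_sum_left)
  moreover have "(\<Sum>j\<in>I. g p (X p) (Y p) *\<^sub>R \<xi> j p) = g p (X p) (Y p) *\<^sub>R xib p"
    by (simp add: xib_def scaleR_sum_right)
  ultimately show ?thesis
    by (simp add: semi_symmetric_metric_connection_def I_def)
qed

lemma VF_Dstar [simp]: "VF X \<Longrightarrow> VF Y \<Longrightarrow> VF (Dstar X Y)"
  by (rule VF_cong[of "\<lambda>p. D X Y p + g p (Y p) (xib p) *\<^sub>R X p - g p (X p) (Y p) *\<^sub>R xib p"])
    (simp_all add: Dstar_eq)

lemma sectional_Dstar:
  assumes [simp]: "VF X" "VF Y" and p [simp]: "p \<in> U"
    and on: "\<And>q. q \<in> U \<Longrightarrow> g q (X q) (X q) = 1" "\<And>q. q \<in> U \<Longrightarrow> g q (Y q) (Y q) = 1"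
      "\<And>q. q \<in> U \<Longrightarrow> g q (X q) (Y q) = 0"
  shows "sectional_curvature A g Dstar X Y p =
    Rm X Y Y X p - real s + (g p (X p) (xib p))\<^sup>2 + (g p (Y p) (xib p))\<^sup>2"
proof -
  let ?e = "\<lambda>V q. g q (V q) (xib q)"
  have YX: "g q (Y q) (X q) = 0" if "q \<in> U" for q
    using on(3)[OF that] that by (simp add: g_sym[of "Y q" q "X q"])
  have self: "g p (X p) (f p (X p)) = 0" "g p (Y p) (f p (Y p)) = 0"
    using g_f_skew[of "X p" p "X p"] g_f_skew[of "Y p" p "Y p"] by simp_all
  \<comment> \<open>The orthonormality relations hold on all of \<open>U\<close>, so they may be
    differentiated.\<close>
  have const: "g p (D V W p) (Z p) + g p (W p) (D V Z p) = 0"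
    if [simp]: "VF V" "VF W" "VF Z" and a: "\<And>q. q \<in> U \<Longrightarrow> g q (W q) (Z q) = a" for V W Z a
  proof -
    have "V p (\<lambda>q. g q (W q) (Z q)) = V p (\<lambda>q. a)"
      by (rule der_cong[of V]) (simp_all add: a)
    then show ?thesis using der_simps(1)[of V p] by (simp add: D_metric[of V])
  qed
  have DXX: "g p (D V X p) (X p) = 0" and DYY: "g p (D V Y p) (Y p) = 0"
    and DXY: "g p (D V X p) (Y p) = - g p (D V Y p) (X p)" if [simp]: "VF V" for V
    using const[of V X X 1] const[of V Y Y 1] const[of V X Y 0] on
    by (simp_all add: g_sym[of _ p "D V X p"] g_sym[of _ p "D V Y p"])
  \<comment> \<open>As |Y| = 1, \<open>Dstar Y Y\<close> contains -\<open>xib\<close>. Its product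
    with \<open>xib\<close> gives -s, its product with X gives the square of \<eta>(X), and its
    derivative s f X is orthogonal to X.\<close>
  have 1: "g p (Dstar X (Dstar Y Y) p) (X p) = g p (D X (D Y Y) p) (X p)
      + ?e Y p * g p (D X Y p) (X p) + ?e (D Y Y) p + (?e Y p)\<^sup>2 - real s
      - g p (D Y Y p) (X p) * ?e X p + (?e X p)\<^sup>2"
  proof -
    have "D X (Dstar Y Y) p = D X (\<lambda>q. D Y Y q + ?e Y q *\<^sub>R Y q - xib q) p"
      by (rule D_cong) (simp_all add: Dstar_eq on)
    then have "D X (Dstar Y Y) p = D X (D Y Y) p
        + (X p (?e Y) *\<^sub>R Y p + ?e Y p *\<^sub>R D X Y p) + real s *\<^sub>R f p (X p)"
      by (simp add: D_diff_right D_add_right D_scale_right D_xib)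
    then show ?thesis
      by (simp add: Dstar_eq on YX self xib_xib g_sym[of "X p" p "D Y Y p"] g_sym[of "xib p" p "X p"]
          power2_eq_square algebra_simps)
  qed
  \<comment> \<open>Since X and Y are orthogonal, \<open>Dstar X Y\<close> has no \<open>xib\<close>
    term.\<close>
  have 2: "g p (Dstar Y (Dstar X Y) p) (X p) = g p (D Y (D X Y) p) (X p) + ?e (D Y Y) p"
  proof -
    have "D Y (Dstar X Y) p = D Y (\<lambda>q. D X Y q + ?e Y q *\<^sub>R X q) p"
      by (rule D_cong) (simp_all add: Dstar_eq on)
    then have "D Y (Dstar X Y) p = D Y (D X Y) p
        + (Y p (?e Y) *\<^sub>R X p + ?e Y p *\<^sub>R D Y X p)"
      by (simp add: D_add_right D_scale_right)
    moreover have "Y p (?e Y) = ?e (D Y Y) p"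
      by (simp add: D_metric[of Y] D_xib self)
    ultimately show ?thesis
      by (simp add: Dstar_eq on YX DXX DYY g_sym[of "Y p" p "D X Y p"])
  qed
  have 3: "g p (Dstar (bracket X Y) Y p) (X p) = g p (D (bracket X Y) Y p) (X p)
      + ?e Y p * g p (D X Y p) (X p) - g p (D Y Y p) (X p) * ?e X p"
    by (simp add: Dstar_eq bracket_eq DXX DYY DXY g_sym[of "xib p" p "X p"] algebra_simps)
  have "sectional_curvature A g Dstar X Y p = g p (Dstar X (Dstar Y Y) p) (X p)
      - g p (Dstar Y (Dstar X Y) p) (X p) - g p (Dstar (bracket X Y) Y p) (X p)"
    by (simp add: sectional_curvature_def curvature_def)
  then show ?thesis
    unfolding 1 2 3 by (simp add: Rm_eq)
qed

lemma L_sectional_Dstar: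
  assumes c: "constant_f_sectional_curvature A s f \<xi> g D c"
    and [simp]: "LF X" "LF Y" "p \<in> U"
    and on: "\<And>q. q \<in> U \<Longrightarrow> g q (X q) (X q) = 1" "\<And>q. q \<in> U \<Longrightarrow> g q (Y q) (Y q) = 1"
      "\<And>q. q \<in> U \<Longrightarrow> g q (X q) (Y q) = 0"
  shows "sectional_curvature A g Dstar X Y p = (c - real s) / 4 * (1 + 3 * (g p (X p) (f p (Y p)))\<^sup>2)"
proof -
  have "sectional_curvature A g Dstar X Y p = Rm X Y Y X p - real s"
    using sectional_Dstar[of X Y p] on by simp
  \<comment> \<open>Since (c + 3s)/4 - s = (c - s)/4, the two coefficients acquire a common
    factor.\<close>
  then show ?thesis by (simp add: Rm_LF[OF c] on field_simps)
qed

lemma scalar_Dstar: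
  assumes c: "constant_f_sectional_curvature A s f \<xi> g D c"
    and frame: "local_orthonormal_frame A g U e" and p [simp]: "p \<in> U"
  shows "scalar_curvature A g Dstar e p = (real n * (real n + 1) * (c - real s)
    + (4 * real n * real s + real s * (real s - 1)) * (2 - real s)) / 2"
proof -
  let ?N = "{1..DIM('b)}"
  have VF [simp]: "VF (e i)" if "i \<in> ?N" for i
    using frame that unfolding local_orthonormal_frame_def by blast
  have on: "g q (e i q) (e j q) = (if i = j then 1 else 0)" if "q \<in> U" "i \<in> ?N" "j \<in> ?N" for q i j
    using frame that unfolding local_orthonormal_frame_def by blast
  have T: "e i p \<in> T p" if "i \<in> ?N" for i using that by simp
  have pars: "(\<Sum>i\<in>?N. g p x (e i p) * g p (e i p) y) = g p x y" if "x \<in> T p" "y \<in> T p" for x y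
    using parseval[of "\<lambda>i. e i p" p x y] that T on by simp
  \<comment> \<open>In the frame, \<open>m\<close> is the matrix of the orthogonal projection onto
    L, \<open>h\<close> the coordinate vector of \<open>xib\<close>, and \<open>P\<close> the matrix
    of f.\<close>
  define m where "m i j = - g p (e i p) (f p (f p (e j p)))" for i j
  define h where "h i = g p (e i p) (xib p)" for i
  define P where "P i j = g p (e i p) (f p (e j p))" for i j
  define a b where "a = (c + 3 * real s) / 4" and "b = 3 * (c - real s) / 4"
  have m_sym: "m i j = g p (f p (f p (- e i p))) (e j p)" if "i \<in> ?N" "j \<in> ?N" for i j
    using T[OF that(1)] T[OF that(2)] by (simp add: m_def)
  define K where "K i j = a * (m i i * m j j - (m i j)\<^sup>2) + b * (P i j)\<^sup>2 + (h j)\<^sup>2 * m i i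
    + (h i)\<^sup>2 * m j j - 2 * h i * h j * m i j" for i j
  have Rm_K: "Rm (e i) (e j) (e j) (e i) p = K i j" if "i \<in> ?N" "j \<in> ?N" for i j
    using Rm_general[OF c VF[OF that(1)] VF[OF that(2)] p]
    by (simp add: K_def m_def h_def P_def a_def b_def)
  have P0: "P i i = 0" if "i \<in> ?N" for i
    using g_f_skew[OF T[OF that] T[OF that]] by (simp add: P_def)
  \<comment> \<open>With a zero diagonal K may be summed over all pairs; the diagonal to be
    subtracted is then only -s + 2 (h i)^2.\<close>
  have K_diag: "K i i = 0" if "i \<in> ?N" for i
    using P0[OF that] by (simp add: K_def power2_eq_square algebra_simps)
  let ?L = "\<lambda>i j. K i j - real s + (h i)\<^sup>2 + (h j)\<^sup>2"
  have sec: "sectional_curvature A g Dstar (e i) (e j) p = ?L i j"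
    if "i \<in> ?N" "j \<in> ?N" "i \<noteq> j" for i j
    using sectional_Dstar[of "e i" "e j" p] Rm_K that on by (simp add: h_def)
  have "2 * scalar_curvature A g Dstar e p = (\<Sum>i\<in>?N. \<Sum>j\<in>?N. ?L i j - (if i = j then ?L i i else 0))"
    unfolding scalar_curvature_def
    by (simp, intro sum.cong refl) (simp add: sec)
  also have "\<dots> = (\<Sum>i\<in>?N. (\<Sum>j\<in>?N. ?L i j) - ?L i i)"
    by (rule sum.cong[OF refl]) (simp add: sum_subtractf)
  also have "\<dots> = (\<Sum>i\<in>?N. \<Sum>j\<in>?N. K i j) - real DIM('b) * (real DIM('b) * real s)
      + 2 * real DIM('b) * (\<Sum>i\<in>?N. (h i)\<^sup>2) + real DIM('b) * real s - 2 * (\<Sum>i\<in>?N. (h i)\<^sup>2)"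
    by (simp add: K_diag sum.distrib sum_subtractf sum_distrib_left algebra_simps)
  finally have scal: "2 * scalar_curvature A g Dstar e p = \<dots>" .
  \<comment> \<open>The trace of the projection: the dimension 2n + s minus 1 for each structure
    field.\<close>
  have mm: "(\<Sum>i\<in>?N. m i i) = 2 * real n"
  proof -
    have "m i i = 1 - (\<Sum>\<alpha>\<in>I. g p (\<xi> \<alpha> p) (e i p) * g p (e i p) (\<xi> \<alpha> p))" if i: "i \<in> ?N" for i
      using on[OF p i i] T[OF i] by (simp add: m_def f_f g_sum_right g_sym[of "\<xi> _ p" p "e i p"])
    then have "(\<Sum>i\<in>?N. m i i) = real DIM('b)
        - (\<Sum>i\<in>?N. \<Sum>\<alpha>\<in>I. g p (\<xi> \<alpha> p) (e i p) * g p (e i p) (\<xi> \<alpha> p))"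
      by (simp add: sum_subtractf)
    also have "(\<Sum>i\<in>?N. \<Sum>\<alpha>\<in>I. g p (\<xi> \<alpha> p) (e i p) * g p (e i p) (\<xi> \<alpha> p)) = (\<Sum>\<alpha>\<in>I. 1)"
      by (subst sum.swap, rule sum.cong[OF refl]) (simp only: pars xi_T xi_xi simp_thms if_True)
    finally show ?thesis using dims by simp
  qed
  \<comment> \<open>Idempotence of the symmetric matrix \<open>m\<close>, read on its
    diagonal.\<close>
  have m2: "(\<Sum>j\<in>?N. (m i j)\<^sup>2) = m i i" if i: "i \<in> ?N" for i
  proof -
    let ?x = "- f p (f p (e i p))"
    have "(m i j)\<^sup>2 = g p ?x (e j p) * g p (e j p) ?x" if j: "j \<in> ?N" for j
      using T[OF i] T[OF j] g_f_skew[of "f p (e j p)" p "e i p"] 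
      by (simp add: m_def power2_eq_square g_sym[of "f p (f p (e i p))" p "e j p"])
    then have "(\<Sum>j\<in>?N. (m i j)\<^sup>2) = g p ?x ?x"
      using pars[of ?x ?x] T[OF i] by simp
    then show ?thesis using T[OF i] by (simp add: m_def)
  qed
  have P2: "(\<Sum>i\<in>?N. (P i j)\<^sup>2) = m j j" if j: "j \<in> ?N" for j
  proof -
    let ?x = "f p (e j p)"
    have "(P i j)\<^sup>2 = g p ?x (e i p) * g p (e i p) ?x" if i: "i \<in> ?N" for i
      using T[OF i] T[OF j] by (simp add: P_def power2_eq_square g_sym[of "e i p" p ?x] del: g_f)
    then have "(\<Sum>i\<in>?N. (P i j)\<^sup>2) = g p ?x ?x"
      using pars[of ?x ?x] T[OF j] by simp
    then show ?thesis using T[OF j] by (simp add: m_def)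
  qed
  have h2: "(\<Sum>i\<in>?N. (h i)\<^sup>2) = real s"
  proof -
    have "(h i)\<^sup>2 = g p (xib p) (e i p) * g p (e i p) (xib p)" if i: "i \<in> ?N" for i
      using T[OF i] by (simp add: h_def power2_eq_square g_sym[of "xib p" p "e i p"])
    then show ?thesis using pars[of "xib p" "xib p"] by (simp add: xib_xib)
  qed
  \<comment> \<open>The projection onto L annihilates \<open>xib\<close>.\<close>
  have hm: "(\<Sum>j\<in>?N. h j * m i j) = 0" if i: "i \<in> ?N" for i
  proof -
    let ?x = "- f p (f p (e i p))"
    have "h j * m i j = g p (xib p) (e j p) * g p (e j p) ?x" if j: "j \<in> ?N" for j
      using T[OF i] T[OF j] g_f_skew[of "f p (e j p)" p "e i p"]
      by (simp add: h_def m_def g_sym[of "xib p" p "e j p"])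
    then show ?thesis using pars[of "xib p" ?x] T[OF i] by simp
  qed
  have "(\<Sum>i\<in>?N. \<Sum>j\<in>?N. K i j) = a * ((\<Sum>i\<in>?N. m i i) * (\<Sum>j\<in>?N. m j j) - (\<Sum>i\<in>?N. \<Sum>j\<in>?N. (m i j)\<^sup>2))
      + b * (\<Sum>i\<in>?N. \<Sum>j\<in>?N. (P i j)\<^sup>2)
      + (\<Sum>i\<in>?N. m i i) * (\<Sum>j\<in>?N. (h j)\<^sup>2) + (\<Sum>i\<in>?N. (h i)\<^sup>2) * (\<Sum>j\<in>?N. m j j)
      - 2 * (\<Sum>i\<in>?N. h i * (\<Sum>j\<in>?N. h j * m i j))"
    unfolding K_def sum_product
    by (simp add: sum.distrib sum_subtractf sum_distrib_left algebra_simps)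
  also have "(\<Sum>i\<in>?N. \<Sum>j\<in>?N. (m i j)\<^sup>2) = 2 * real n"
    using m2 mm by simp
  also have "(\<Sum>i\<in>?N. \<Sum>j\<in>?N. (P i j)\<^sup>2) = 2 * real n"
    using P2 mm by (subst sum.swap) simp
  also have "(\<Sum>i\<in>?N. h i * (\<Sum>j\<in>?N. h j * m i j)) = 0"
    using hm by simp
  finally have KK: "(\<Sum>i\<in>?N. \<Sum>j\<in>?N. K i j) = a * (2 * real n * (2 * real n) - 2 * real n) + b * (2 * real n)
      + 2 * real n * real s + real s * (2 * real n) - 2 * 0"
    unfolding mm h2 .
  have N: "real DIM('b) = 2 * real n + real s" using dims(3) by simp
  have "4 * (2 * scalar_curvature A g Dstar e p) = 4 * (real n * (real n + 1) * (c - real s)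
    + (4 * real n * real s + real s * (real s - 1)) * (2 - real s))"
    unfolding scal KK h2 N by (simp add: a_def b_def field_simps)
  then show ?thesis by simp
qed

end


theorem mainTheorem6:
  fixes A :: "('a::{t2_space, second_countable_topology}, 'b::euclidean_space) atlas"
    and n s :: nat
    and f :: "'a \<Rightarrow> 'a tangent \<Rightarrow> 'a tangent"
    and \<xi> :: "nat \<Rightarrow> 'a vfield"
    and \<eta> :: "nat \<Rightarrow> 'a \<Rightarrow> 'a tangent \<Rightarrow> real"
    and g :: "'a \<Rightarrow> 'a tangent \<Rightarrow> 'a tangent \<Rightarrow> real"
    and nabla nabla_star :: "'a vfield \<Rightarrow> 'a vfield \<Rightarrow> 'a vfield"
    and c :: real
  assumes "S_manifold A n s f \<xi> \<eta> g"
    and "levi_civita A g nabla"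
    and "constant_f_sectional_curvature A s f \<xi> g nabla c"
    and "nabla_star = semi_symmetric_metric_connection s \<xi> \<eta> g nabla"
  shows
    "(\<forall>U X Y. open U \<and> L_section A s \<xi> g U X \<and> L_section A s \<xi> g U Y \<and>
        (\<forall>p\<in>U. g p (X p) (X p) = 1 \<and> g p (Y p) (Y p) = 1 \<and> g p (X p) (Y p) = 0) \<longrightarrow>
        (\<forall>p\<in>U. sectional_curvature A g nabla_star X Y p =
           (c - real s) / 4 * (1 + 3 * (g p (X p) (f p (Y p)))\<^sup>2))) \<and>
     (\<forall>U e. local_orthonormal_frame A g U e \<longrightarrow>
        (\<forall>p\<in>U. scalar_curvature A g nabla_star e p =
           (real n * (real n + 1) * (c - real s)
            + (4 * real n * real s + real s * (real s - 1)) * (2 - real s)) / 2))"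
proof -
  have "metric_f_manifold A n s f \<xi> \<eta> g"
    using assms(1) unfolding S_manifold_def by simp
  then have "smooth_manifold A" "riemannian_metric A g"
    unfolding metric_f_manifold_def by simp_all
  \<comment> \<open>Both claims concern fields on an arbitrary open set, so the locale is
    instantiated separately for each \<open>U\<close>.\<close>
  then have patch: "S_patch A g nabla U n s f \<xi> \<eta>" if "open U" for U
    using assms(1,2) that by unfold_locales
  show ?thesis
  proof (intro conjI allI impI ballI)
    fix U X Y p
    assume *: "open U \<and> L_section A s \<xi> g U X \<and> L_section A s \<xi> g U Y \<and>
        (\<forall>p\<in>U. g p (X p) (X p) = 1 \<and> g p (Y p) (Y p) = 1 \<and> g p (X p) (Y p) = 0)" "p \<in> U"
    interpret S_patch A g nabla U n s f \<xi> \<eta> using patch * by blast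
    show "sectional_curvature A g nabla_star X Y p =
        (c - real s) / 4 * (1 + 3 * (g p (X p) (f p (Y p)))\<^sup>2)"
      unfolding assms(4)
      by (rule L_sectional_Dstar[OF assms(3)]) (use * in \<open>auto simp: L_section_iff_LF\<close>)
  next
    fix U e p assume *: "local_orthonormal_frame A g U e" "p \<in> U"
    then have "open U" unfolding local_orthonormal_frame_def by simp
    then interpret S_patch A g nabla U n s f \<xi> \<eta> by (rule patch)
    show "scalar_curvature A g nabla_star e p =
           (real n * (real n + 1) * (c - real s)
            + (4 * real n * real s + real s * (real s - 1)) * (2 - real s)) / 2"
      unfolding assms(4) by (rule scalar_Dstar[OF assms(3) *])
  qed
qed

end
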